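(* Let $G=Sp_{2n}(\mathbb{C})$. With the notation of the context: (1) For fixed $\lambda\in P_+$, the Gelfand--Tsetlin polytope $GT_{C_n}(\lambda)$ and the FFLV polytope $FFLV_{C_n}(\lambda)$ are related by combinatorial mutations in $M_{\mathbb{R}}$ up to translations by integer vectors; that is, there are integer vectors such that the translates of $GT_{C_n}(\lambda)$ and $FFLV_{C_n}(\lambda)$ by these vectors are combinatorially mutation equivalent in $M_{\mathbb{R}}$. (2) The dual polytopes $GT_{C_n}(2\rho)^\vee$ and $FFLV_{C_n}(2\rho)^\vee$ are related by combinatorial mutations in $N_{\mathbb{R}}$, i.e. they are combinatorially mutation equivalent in $N_{\mathbb{R}}$.
   Context: **Polytopes.** $P_+$ is the set of dominant integral weights of $G=Sp_{2n}(\mathbb{C})$ and $\rho$ the half sum of positive roots. The Dynkin diagram vertices are labelled $1,\dots,n$ along the diagram so that the double edge joins $1$ and $2$, with vertex $1$ the end vertex carrying the long simple root; $h_i$ are the simple coroots. Put $\lambda_{\le k}=\sum_{1\le\ell\le k}\langle\lambda,h_\ell\rangle$. Consider the poset $\widetilde\Pi$ with elements $\mathsf{a}^{(l)}_k$ ($1\le l\le n$, $1\le k\le n+1-l$) and $\mathsf{b}^{(l)}_k$ ($1\le l\le n$, $1\le k\le n+2-l$), with partial order generated by $\mathsf{b}^{(l)}_{k+1}\prec\mathsf{a}^{(l)}_k\prec\mathsf{b}^{(l)}_k$ for $1\le l\le n$, $1\le k\le n+1-l$, and $\mathsf{a}^{(l-1)}_{k+1}\prec\mathsf{b}^{(l)}_k\prec\mathsf{a}^{(l-1)}_k$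 for $2\le l\le n$, $1\le k\le n+1-l$. Let $A\subset\widetilde\Pi$ consist of $\mathsf{b}^{(1)}_k$ ($1\le k\le n$), marked by $\lambda_{\le n+1-k}$, and of the elements $\mathsf{b}^{(l)}_{n+2-l}$ ($1\le l\le n$), marked by $0$. Write $\lambda_a$ for the mark of $a\in A$. Then $|\widetilde\Pi\setminus A|=n^2$ and - $GT_{C_n}(\lambda)$ is the set of $(x_p)\in\mathbb{R}^{\widetilde\Pi\setminus A}$ with $x_p\le x_q$ if $p\prec q$, $\lambda_a\le x_p$ if $a\prec p$, and $x_p\le\lambda_a$ if $p\prec a$ ($p,q\in\widetilde\Pi\setminus A$, $a\in A$), i.e. the type $C_n$ Gelfand--Tsetlin patterns with top row $\lambda_{\le n},\lambda_{\le n-1},\dots,\lambda_{\le1},0$; - $FFLV_{C_n}(\lambda)$ is the set of $(x_p)\in\mathbb{R}_{\ge0}^{\widetilde\Pi\setminus A}$ with $\sum_{i=1}^kx_{p_i}\le\lambda_b-\lambda_a$ for all chains $a\prec p_1\prec\cdots\prec p_k\prec b$ with $a,b\in A$, $p_i\in\widetilde\Pi\setminus A$. **Lattices and duals.** $M=\mathbb{Z}^{\widetilde\Pi\setminus A}$, $N={\rm Hom}_{\mathbb{Z}}(M,\mathbb{Z})$, $M_{\mathbb{R}},N_{\mathbb{R}}$ their real extensions, $\langle\cdot,\cdot\rangle:M_{\mathbb{R}}\times N_{\mathbb{R}}\to\mathbb{R}$ the pairing; both polytopes are in $M_{\mathbb{R}}$. For a rational polytope $\Delta\subseteq M_{\mathbb{R}}$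 with a unique interior lattice point $\boldsymbol a$, $\Delta^\vee=\{v\in N_{\mathbb{R}}\mid\langle u-\boldsymbol a,v\rangle\ge-1\ \forall u\in\Delta\}$. For $\lambda=2\rho$ both polytopes are known to have a unique interior lattice point, and the duals are lattice polytopes. **Combinatorial mutations.** Let $w\in M$ be primitive and $F\subseteq w^\perp=\{v\in N_{\mathbb R}\mid \langle w,v\rangle=0\}$ a lattice polytope. - In $M_{\mathbb{R}}$: $\varphi_{w,F}(u)=u-\min\{\langle u,v\rangle\mid v\in F\}\,w$. Rational convex polytopes $Q,Q'\subseteq M_{\mathbb{R}}$ are combinatorially mutation equivalent in $M_{\mathbb{R}}$ if $Q'=\varphi_{w_\ell,F_\ell}(\cdots\varphi_{w_1,F_1}(Q)\cdots)$ for some such pairs $(w_i,F_i)$, with every intermediate image a rational convex polytope. - In $N_{\mathbb{R}}$: for a lattice polytope $P\subseteq N_{\mathbb{R}}$ with vertex set $V(P)$ put $H_{w,h}=\{v\mid\langle w,v\rangle=h\}$, $P_{w,h}=P\cap H_{w,h}$. ${\rm mut}_w(P,F)$ is well-defined if for every integer $h<0$ there is a possibly empty lattice polytope $G_h$ with $V(P)\cap H_{w,h}\subseteq G_h+|h|F\subseteq P_{w,h}$ (with $\emptyset+A=\emptyset$); then ${\rm mut}_w(P,F)={\rm conv}\big(\bigcup_{h\le-1}G_h\cup\bigcup_{h\ge0}(P_{w,h}+hF)\big)$, independent of the $G_h$. Lattice polytopes are combinatorially mutation equivalent in $N_{\mathbb{R}}$ if one is obtained from the other by a finite sequence of well-defined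 such mutations. *)

theory Defs
  imports "HOL-Analysis.Analysis"
begin

text \<open>
  A weight is given by its coordinates in the basis \<open>\<epsilon>\<^sub>1, \<dots>, \<epsilon>\<^sub>n\<close>, as a function supported on
  \<open>{1..n}\<close>. The simple roots are numbered from the long end of the Dynkin diagram:
  \<open>\<alpha>\<^sub>1 = 2\<epsilon>\<^sub>1\<close> is the long simple root and \<open>\<alpha>\<^sub>i = \<epsilon>\<^sub>i - \<epsilon>\<^sub>i\<^sub>-\<^sub>1\<close> for \<open>i \<ge> 2\<close>.
\<close>

type_synonym weight = "nat \<Rightarrow> real"

definition eps :: "nat \<Rightarrow> weight" where
  "eps i = (\<lambda>j. if j = i then 1 else 0)"

definition simple_root :: "nat \<Rightarrow> weight" where
  "simple_root i = (if i = 1 then (\<lambda>j. 2 * eps 1 j) else (\<lambda>j. eps i j - eps (i - 1) j))"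

definition positive_roots :: "nat \<Rightarrow> weight set" where
  "positive_roots n =
     {\<lambda>m. 2 * eps i m | i. 1 \<le> i \<and> i \<le> n} \<union>
     {\<lambda>m. eps j m - eps i m | i j. 1 \<le> i \<and> i < j \<and> j \<le> n} \<union>
     {\<lambda>m. eps j m + eps i m | i j. 1 \<le> i \<and> i < j \<and> j \<le> n}"

definition rho :: "nat \<Rightarrow> weight" where
  "rho n = (\<lambda>m. (\<Sum>\<alpha>\<in>positive_roots n. \<alpha> m) / 2)"

text \<open>The pairing \<open>\<langle>x, h\<^sub>i\<rangle> = 2 (x, \<alpha>\<^sub>i) / (\<alpha>\<^sub>i, \<alpha>\<^sub>i)\<close> with the \<open>i\<close>-th simple coroot.\<close>

definition coroot_pairing :: "nat \<Rightarrow> weight \<Rightarrow> nat \<Rightarrow> real" where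
  "coroot_pairing n x i =
     2 * (\<Sum>m=1..n. x m * simple_root i m) / (\<Sum>m=1..n. simple_root i m * simple_root i m)"

text \<open>
  As the symplectic group is simply connected, its weights are exactly the vectors
  that pair integrally with all simple coroots.
\<close>

definition dominant_weights :: "nat \<Rightarrow> weight set" where
  "dominant_weights n =
     {x. (\<forall>m. m \<notin> {1..n} \<longrightarrow> x m = 0) \<and>
         (\<forall>i\<in>{1..n}. coroot_pairing n x i \<in> \<int> \<and> 0 \<le> coroot_pairing n x i)}"

definition weight_partial_sum :: "nat \<Rightarrow> weight \<Rightarrow> nat \<Rightarrow> real" where
  "weight_partial_sum n x k = (\<Sum>l=1..k. coroot_pairing n x l)"

text \<open>\<open>ANode l k\<close> and \<open>BNode l k\<close> stand for \<open>a\<^sub>k\<close> and \<open>b\<^sub>k\<close> with upper index \<open>(l)\<close>.\<close>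

datatype node = ANode nat nat | BNode nat nat

definition poset :: "nat \<Rightarrow> node set" where
  "poset n =
     {ANode l k | l k. 1 \<le> l \<and> l \<le> n \<and> 1 \<le> k \<and> k \<le> n + 1 - l} \<union>
     {BNode l k | l k. 1 \<le> l \<and> l \<le> n \<and> 1 \<le> k \<and> k \<le> n + 2 - l}"

definition marked :: "nat \<Rightarrow> node set" where
  "marked n =
     {BNode 1 k | k. 1 \<le> k \<and> k \<le> n} \<union> {BNode l (n + 2 - l) | l. 1 \<le> l \<and> l \<le> n}"

inductive generating_rel :: "nat \<Rightarrow> node \<Rightarrow> node \<Rightarrow> bool" for n :: nat where
  "\<lbrakk>1 \<le> l; l \<le> n; 1 \<le> k; k \<le> n + 1 - l\<rbrakk> \<Longrightarrow> generating_rel n (BNode l (k + 1)) (ANode l k)"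
| "\<lbrakk>1 \<le> l; l \<le> n; 1 \<le> k; k \<le> n + 1 - l\<rbrakk> \<Longrightarrow> generating_rel n (ANode l k) (BNode l k)"
| "\<lbrakk>2 \<le> l; l \<le> n; 1 \<le> k; k \<le> n + 1 - l\<rbrakk> \<Longrightarrow> generating_rel n (ANode (l - 1) (k + 1)) (BNode l k)"
| "\<lbrakk>2 \<le> l; l \<le> n; 1 \<le> k; k \<le> n + 1 - l\<rbrakk> \<Longrightarrow> generating_rel n (BNode l k) (ANode (l - 1) k)"

definition prec :: "nat \<Rightarrow> node \<Rightarrow> node \<Rightarrow> bool" where
  "prec n = (generating_rel n)\<^sup>+\<^sup>+"

text \<open>Only the values on \<open>marked n\<close> are meaningful.\<close>

definition mark :: "nat \<Rightarrow> weight \<Rightarrow> node \<Rightarrow> real" where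
  "mark n x a =
     (case a of
        BNode l k \<Rightarrow> if l = 1 \<and> k \<le> n then weight_partial_sum n x (n + 1 - k) else 0
      | ANode l k \<Rightarrow> 0)"

text \<open>
  The unmarked elements, as a finite index type; the rank is \<open>n = CARD('n)\<close>.
\<close>

typedef (overloaded) ('n::finite) coord = "poset CARD('n) - marked CARD('n)"
  by (rule exI[of _ "ANode 1 1"]) (auto simp: poset_def marked_def Suc_le_eq)

instance coord :: (finite) finite
proof
  have "finite (poset n)" for n
    by (rule finite_subset[of _ "case_prod ANode ` ({..n} \<times> {..n + 1}) \<union>
          case_prod BNode ` ({..n} \<times> {..n + 2})"])
      (auto simp: poset_def image_iff)
  then have "finite (poset CARD('a) - marked CARD('a))"
    by simp
  then show "finite (UNIV :: 'a coord set)"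
    by (metis finite_imageI type_definition.univ type_definition_coord)
qed

definition GT :: "weight \<Rightarrow> (real ^ ('n::finite) coord) set" where
  "GT x = (let n = CARD('n) in
     {u. (\<forall>p q. prec n (Rep_coord p) (Rep_coord q) \<longrightarrow> u $ p \<le> u $ q) \<and>
         (\<forall>a\<in>marked n. \<forall>p.
            (prec n a (Rep_coord p) \<longrightarrow> mark n x a \<le> u $ p) \<and>
            (prec n (Rep_coord p) a \<longrightarrow> u $ p \<le> mark n x a))})"

definition FFLV :: "weight \<Rightarrow> (real ^ ('n::finite) coord) set" where
  "FFLV x = (let n = CARD('n) in
     {u. (\<forall>p. 0 \<le> u $ p) \<and>
         (\<forall>a\<in>marked n. \<forall>b\<in>marked n. \<forall>ps.
            ps \<noteq> [] \<and> sorted_wrt (prec n) (a # map Rep_coord ps @ [b]) \<longrightarrow>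
            (\<Sum>p\<leftarrow>ps. u $ p) \<le> mark n x b - mark n x a)})"

text \<open>
  Both \<open>M\<^sub>\<real>\<close> and \<open>N\<^sub>\<real>\<close> are \<open>real ^ 'p\<close>: \<open>N\<^sub>\<real>\<close> is written in the basis dual to the
  standard basis of \<open>M\<close>, so that \<open>N\<close> consists of the integral vectors as well and the
  pairing of \<open>M\<^sub>\<real>\<close> and \<open>N\<^sub>\<real>\<close> is the inner product.
\<close>

definition lattice_points :: "(real ^ 'p) set" where
  "lattice_points = {u. \<forall>i. u $ i \<in> \<int>}"

definition rational_points :: "(real ^ 'p) set" where
  "rational_points = {u. \<forall>i. u $ i \<in> \<rat>}"

text \<open>Polytopes are nonempty by convention; the empty set is allowed explicitly where needed.\<close>

definition lattice_polytope :: "(real ^ 'p::finite) set \<Rightarrow> bool" where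
  "lattice_polytope P \<longleftrightarrow>
     (\<exists>V. finite V \<and> V \<noteq> {} \<and> V \<subseteq> lattice_points \<and> P = convex hull V)"

definition rational_polytope :: "(real ^ 'p::finite) set \<Rightarrow> bool" where
  "rational_polytope P \<longleftrightarrow>
     (\<exists>V. finite V \<and> V \<noteq> {} \<and> V \<subseteq> rational_points \<and> P = convex hull V)"

definition primitive :: "real ^ 'p::finite \<Rightarrow> bool" where
  "primitive w \<longleftrightarrow> w \<in> lattice_points \<and> w \<noteq> 0 \<and>
     (\<forall>(k::int). \<forall>u\<in>lattice_points. w = of_int k *\<^sub>R u \<longrightarrow> \<bar>k\<bar> = 1)"

text \<open>Meaningful only if there is exactly one interior lattice point.\<close>

definition dual :: "(real ^ 'p::finite) set \<Rightarrow> (real ^ 'p) set" where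
  "dual \<Delta> = (let a = (THE a. a \<in> interior \<Delta> \<and> a \<in> lattice_points) in
     {v. \<forall>u\<in>\<Delta>. (u - a) \<bullet> v \<ge> -1})"

definition mutation_datum :: "real ^ 'p::finite \<Rightarrow> (real ^ 'p) set \<Rightarrow> bool" where
  "mutation_datum w F \<longleftrightarrow> primitive w \<and> lattice_polytope F \<and> F \<subseteq> {v. w \<bullet> v = 0}"

text \<open>The infimum is attained, as \<open>F\<close> is a (nonempty) polytope.\<close>

definition trop_map :: "real ^ 'p::finite \<Rightarrow> (real ^ 'p) set \<Rightarrow> real ^ 'p \<Rightarrow> real ^ 'p" where
  "trop_map w F u = u - (INF v\<in>F. u \<bullet> v) *\<^sub>R w"

definition mutation_M :: "(real ^ 'p::finite) set \<Rightarrow> (real ^ 'p) set \<Rightarrow> bool" where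
  "mutation_M Q Q' \<longleftrightarrow> rational_polytope Q \<and> rational_polytope Q' \<and>
     (\<exists>w F. mutation_datum w F \<and> Q' = trop_map w F ` Q)"

definition mutation_equiv_M :: "(real ^ 'p::finite) set \<Rightarrow> (real ^ 'p) set \<Rightarrow> bool" where
  "mutation_equiv_M Q Q' \<longleftrightarrow>
     rational_polytope Q \<and> rational_polytope Q' \<and> mutation_M\<^sup>*\<^sup>* Q Q'"

definition slice :: "real ^ 'p::finite \<Rightarrow> int \<Rightarrow> (real ^ 'p) set \<Rightarrow> (real ^ 'p) set" where
  "slice w h P = P \<inter> {v. w \<bullet> v = of_int h}"

text \<open>
  \<open>G\<close> witnesses that the mutation of \<open>P\<close> with respect to \<open>w\<close> and \<open>F\<close> is well-defined.
  Sums of sets are Minkowski sums.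
\<close>

definition mutation_witness ::
  "real ^ 'p::finite \<Rightarrow> (real ^ 'p) set \<Rightarrow> (real ^ 'p) set \<Rightarrow> (int \<Rightarrow> (real ^ 'p) set) \<Rightarrow> bool" where
  "mutation_witness w F P G \<longleftrightarrow>
     (\<forall>h<0. (G h = {} \<or> lattice_polytope (G h)) \<and>
        slice w h {v. v extreme_point_of P} \<subseteq> G h + (*\<^sub>R) (of_int \<bar>h\<bar>) ` F \<and>
        G h + (*\<^sub>R) (of_int \<bar>h\<bar>) ` F \<subseteq> slice w h P)"

definition mutation_N :: "(real ^ 'p::finite) set \<Rightarrow> (real ^ 'p) set \<Rightarrow> bool" where
  "mutation_N P P' \<longleftrightarrow> lattice_polytope P \<and>
     (\<exists>w F G. mutation_datum w F \<and> mutation_witness w F P G \<and>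
        P' = convex hull
          ((\<Union>h\<in>{..-1}. G h) \<union> (\<Union>h\<in>{0..}. slice w h P + (*\<^sub>R) (of_int h) ` F)))"

definition mutation_equiv_N :: "(real ^ 'p::finite) set \<Rightarrow> (real ^ 'p) set \<Rightarrow> bool" where
  "mutation_equiv_N P P' \<longleftrightarrow>
     lattice_polytope P \<and> lattice_polytope P' \<and> (mutation_N\<^sup>*\<^sup>* P P' \<or> mutation_N\<^sup>*\<^sup>* P' P)"

end

theory Submission
  imports Defs
begin

text \<open>
  Starting from the maximal unmarked elements, replace one coordinate \<open>x\<^sub>p\<close> after the other by
  \<open>x\<^sub>p - max {x\<^sub>q | q covered by p}\<close>; this transfers the marked order polytope to the marked chain
  polytope. After a translation which makes all lower covers of an element have the same center
  coordinate, each step is a tropical map with \<open>w = - e\<^sub>p\<close> and \<open>F = conv {- e\<^sub>q | q covered by p}\<close>.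
  All intermediate images are cut out by explicit integral inequalities. Those in which \<open>x\<^sub>p\<close> has
  coefficient \<open>1\<close> are \<open>x\<^sub>p - x\<^sub>q \<ge> const\<close> with the constant independent of \<open>q\<close>, so their
  normals form \<open>e\<^sub>p + V(F)\<close> and the step replaces them by the single normal \<open>e\<^sub>p\<close>; a normal
  \<open>v\<close> in which \<open>x\<^sub>p\<close> has coefficient \<open>-1\<close> is replaced by \<open>v + V(F)\<close>. For \<open>2\<rho>\<close> every
  inequality has constant \<open>-1\<close>, so the duals are the convex hulls of the normals, and the same
  step is a mutation in \<open>N\<^sub>\<real>\<close> with witness \<open>G\<^sub>-\<^sub>1 = {e\<^sub>p}\<close>.
\<close>

section \<open>Polyhedra and their mutations\<close>

text \<open>The sign agrees with that in \<open>dual\<close>: with all constants \<open>1\<close>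
  this is the polar of the set of normals.\<close>

definition region :: "((real ^ 'p::finite) \<times> real) set \<Rightarrow> (real ^ 'p) set" where
  "region K = {y. \<forall>(v, d)\<in>K. - d \<le> y \<bullet> v}"

lemma regionD: "y \<in> region K \<Longrightarrow> (v, d) \<in> K \<Longrightarrow> - d \<le> y \<bullet> v"
  by (auto simp: region_def)

text \<open>A half-space containing \<open>E\<close> contains its hull, so the infimum in
  \<open>trop_map\<close> is a minimum over finitely many generators.\<close>

lemma INF_inner_convex_hull:
  fixes E :: "(real ^ 'p::finite) set"
  assumes "finite E" "E \<noteq> {}"
  obtains f where "f \<in> E" "(INF v\<in>convex hull E. u \<bullet> v) = u \<bullet> f"
    "\<And>f'. f' \<in> E \<Longrightarrow> u \<bullet> f \<le> u \<bullet> f'"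
proof -
  obtain f where f: "f \<in> E" "\<And>f'. f' \<in> E \<Longrightarrow> u \<bullet> f \<le> u \<bullet> f'"
    using ex_min_if_finite[of "(\<lambda>v. u \<bullet> v) ` E"] assms by fastforce
  have "convex hull E \<subseteq> {v. u \<bullet> v \<ge> u \<bullet> f}"
    by (rule hull_minimal) (use f in \<open>auto intro: convex_halfspace_ge\<close>)
  then have "(INF v\<in>convex hull E. u \<bullet> v) = u \<bullet> f"
    using f by (intro cInf_eq_minimum) (auto intro: hull_inc)
  then show thesis using that f by blast
qed

text \<open>Along a normal of height \<open>h\<close> with respect to \<open>w\<close>, the map
  subtracts \<open>h\<close> times the minimum over \<open>E\<close>. At height \<open>-1\<close>
  the inequalities for all \<open>g + f\<close> thus merge into one for \<open>g\<close>, height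
  \<open>0\<close> is unaffected, and at height \<open>1\<close> the inequality for \<open>v\<close>
  becomes those for all \<open>v + f\<close>, the minimizer giving the sharp one.\<close>

lemma trop_map_region:
  fixes w :: "real ^ 'p::finite"
  assumes E: "finite E" "E \<noteq> {}" "\<And>f. f \<in> E \<Longrightarrow> w \<bullet> f = 0"
    and g: "w \<bullet> g = -1"
    and K0: "\<And>v d. (v, d) \<in> K0 \<Longrightarrow> w \<bullet> v = 0"
    and K1: "\<And>v d. (v, d) \<in> K1 \<Longrightarrow> w \<bullet> v = 1"
  shows "trop_map w (convex hull E) ` region ((\<lambda>f. (g + f, r)) ` E \<union> K0 \<union> K1) =
    region ({(g, r)} \<union> K0 \<union> (\<lambda>((v, d), f). (v + f, d)) ` (K1 \<times> E))" (is "?T ` region ?K = region ?L")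
proof (intro equalityI subsetI)
  fix y assume "y \<in> ?T ` region ?K"
  then obtain x where x: "x \<in> region ?K" "y = ?T x" by blast
  obtain f where f: "f \<in> E" "(INF v\<in>convex hull E. x \<bullet> v) = x \<bullet> f"
    "\<And>f'. f' \<in> E \<Longrightarrow> x \<bullet> f \<le> x \<bullet> f'"
    using INF_inner_convex_hull[OF E(1,2)] by blast
  have y: "y \<bullet> v = x \<bullet> v - (x \<bullet> f) * (w \<bullet> v)" for v
    unfolding x(2) trop_map_def f(2) by (simp add: inner_diff_left)
  have "- r \<le> y \<bullet> g" using regionD[OF x(1), of "g + f" r] f(1) g E(3)[OF f(1)] by (simp add: y inner_add_right)
  moreover have "- d \<le> y \<bullet> v" if "(v, d) \<in> K0" for v d
    using x(1) that K0[OF that] by (auto simp: y region_def)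
  moreover have "- d \<le> y \<bullet> (v + f')" if "(v, d) \<in> K1" "f' \<in> E" for v d f'
  proof -
    have "- d \<le> x \<bullet> v" using x(1) that by (auto simp: region_def)
    then show ?thesis
      using f(3)[OF that(2)] K1[OF that(1)] E(3)[OF that(2)] by (simp add: y inner_add_right)
  qed
  ultimately show "y \<in> region ?L" by (auto simp: region_def)
next
  fix y assume yL: "y \<in> region ?L"
  obtain f where f: "f \<in> E" "(INF v\<in>convex hull E. y \<bullet> v) = y \<bullet> f"
    "\<And>f'. f' \<in> E \<Longrightarrow> y \<bullet> f \<le> y \<bullet> f'"
    using INF_inner_convex_hull[OF E(1,2)] by blast
  \<comment> \<open>The inverse map: as \<open>w\<close> is orthogonal to \<open>E\<close>, adding a
    multiple of \<open>w\<close> does not change the minimum over \<open>E\<close>.\<close>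
  define x where "x = y + (y \<bullet> f) *\<^sub>R w"
  have x: "x \<bullet> v = y \<bullet> v + (y \<bullet> f) * (w \<bullet> v)" for v
    by (simp add: x_def inner_add_left)
  obtain f2 where f2: "f2 \<in> E" "(INF v\<in>convex hull E. x \<bullet> v) = x \<bullet> f2"
    "\<And>f'. f' \<in> E \<Longrightarrow> x \<bullet> f2 \<le> x \<bullet> f'"
    using INF_inner_convex_hull[OF E(1,2)] by blast
  have "x \<bullet> f2 = y \<bullet> f"
    using f(3)[OF f2(1)] f2(3)[OF f(1)] E(3)[OF f(1)] E(3)[OF f2(1)] by (simp add: x)
  then have "?T x = y"
    unfolding trop_map_def f2(2) by (simp add: x_def)
  moreover have "x \<in> region ?K"
  proof -
    have "- r \<le> x \<bullet> (g + f')" if "f' \<in> E" for f'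
    proof -
      have "- r \<le> y \<bullet> g" using yL by (auto simp: region_def)
      then show ?thesis using f(3)[OF that] E(3)[OF that] g by (simp add: x inner_add_right)
    qed
    moreover have "- d \<le> x \<bullet> v" if "(v, d) \<in> K0" for v d
      using yL that K0[OF that] by (auto simp: x region_def)
    moreover have "- d \<le> x \<bullet> v" if "(v, d) \<in> K1" for v d
    proof -
      have "- d \<le> y \<bullet> (v + f)"
        using yL that f(1) by (force simp: region_def)
      then show ?thesis using K1[OF that] by (simp add: x inner_add_right)
    qed
    ultimately show ?thesis by (auto simp: region_def)
  qed
  ultimately show "y \<in> ?T ` region ?K" by blast
qed

text \<open>Pointwise the map agrees with one of finitely many linear maps, one for each possible
  minimizer.\<close>

lemma bounded_trop_map_image:
  fixes w :: "real ^ 'p::finite"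
  assumes "finite E" "E \<noteq> {}" "bounded Q"
  shows "bounded (trop_map w (convex hull E) ` Q)"
proof -
  have "trop_map w (convex hull E) ` Q \<subseteq> (\<Union>f\<in>E. (\<lambda>u. u - (u \<bullet> f) *\<^sub>R w) ` Q)"
  proof
    fix y assume "y \<in> trop_map w (convex hull E) ` Q"
    then obtain u where u: "u \<in> Q" "y = trop_map w (convex hull E) u" by blast
    show "y \<in> (\<Union>f\<in>E. (\<lambda>u. u - (u \<bullet> f) *\<^sub>R w) ` Q)"
      by (rule INF_inner_convex_hull[OF assms(1,2), of u]) (use u in \<open>auto simp: trop_map_def\<close>)
  qed
  moreover have "bounded_linear (\<lambda>u. u - (u \<bullet> f) *\<^sub>R w)" for f
    by (intro bounded_linear_intros)
  then have "bounded (\<Union>f\<in>E. (\<lambda>u. u - (u \<bullet> f) *\<^sub>R w) ` Q)"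
    using assms by (intro bounded_UN) (auto intro: bounded_linear_image)
  ultimately show ?thesis by (rule bounded_subset[rotated])
qed

section \<open>Rationality of vertices\<close>

lemma ex_rat_linear_functional:
  fixes \<alpha> :: real
  assumes "\<alpha> \<notin> \<rat>"
  obtains f :: "real \<Rightarrow> real" where "\<And>x y. f (x + y) = f x + f y"
    "\<And>q x. q \<in> \<rat> \<Longrightarrow> f (q * x) = q * f x" "f 1 = 0" "f \<alpha> \<noteq> 0"
proof -
  \<comment> \<open>The reals are viewed as a rational vector space. There \<open>1\<close> and
    \<alpha> are independent, so a functional that is \<open>0\<close> at \<open>1\<close> and
    \<open>1\<close> at \<alpha> extends to all reals.\<close>
  interpret vector_space_pair "\<lambda>q x. of_rat q * x :: real" "\<lambda>q x. of_rat q * x :: real"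
    by unfold_locales (simp_all add: algebra_simps of_rat_add of_rat_mult)
  have "\<alpha> \<notin> vs1.span {1}"
  proof
    assume "\<alpha> \<in> vs1.span {1}"
    then obtain k where "\<alpha> = of_rat k" by (auto simp: vs1.span_singleton)
    with assms show False by simp
  qed
  then have ind: "vs1.independent {\<alpha>, 1}"
    by (auto simp: vs1.independent_insert vs1.dependent_single)
  obtain f where f: "Vector_Spaces.linear (\<lambda>q x. of_rat q * x :: real) (\<lambda>q x. of_rat q * x :: real) f"
    "\<forall>x\<in>{\<alpha>, 1}. f x = (if x = \<alpha> then 1 else 0)"
    using linear_independent_extend[OF ind, of "\<lambda>x. if x = \<alpha> then 1 else 0"] by blast
  interpret f: Vector_Spaces.linear "\<lambda>q x. of_rat q * x :: real" "\<lambda>q x. of_rat q * x :: real" f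
    by (rule f)
  show thesis
  proof
    show "f (q * x) = q * f x" if "q \<in> \<rat>" for q x
      using that f.scale by (auto elim: Rats_cases)
    show "f 1 = 0" "f \<alpha> \<noteq> 0" using f(2) assms by auto
  qed (rule f.add)
qed

lemma region_eq_INT: "region K = (\<Inter>(v, d)\<in>K. {y. - d \<le> v \<bullet> y})"
  by (auto simp: region_def inner_commute)

lemma polyhedron_region:
  assumes "finite K"
  shows "polyhedron (region K)"
  unfolding region_eq_INT
  using assms by (intro polyhedron_Inter) (auto simp: polyhedron_halfspace_ge)

text \<open>
  If some coordinate of \<open>u\<close> is irrational, then applying to all coordinates a \<open>\<rat>\<close>-linear
  functional which kills \<open>1\<close> gives a nonzero direction in which all tight constraints stay tight.
\<close>

lemma extreme_point_region_rational:
  fixes K :: "((real ^ 'p::finite) \<times> real) set"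
  assumes K: "finite K" "K \<subseteq> rational_points \<times> \<rat>" and u: "u extreme_point_of region K"
  shows "u \<in> rational_points"
proof (rule ccontr)
  assume "u \<notin> rational_points"
  then obtain i where i: "u $ i \<notin> \<rat>" by (auto simp: rational_points_def)
  obtain f :: "real \<Rightarrow> real" where f: "\<And>x y. f (x + y) = f x + f y"
    "\<And>q x. q \<in> \<rat> \<Longrightarrow> f (q * x) = q * f x" "f 1 = 0" "f (u $ i) \<noteq> 0"
    using ex_rat_linear_functional[OF i] by metis
  have f0: "f 0 = 0" using f(1)[of 0 0] by simp
  have fsum: "f (sum h S) = (\<Sum>j\<in>S. f (h j))" for h and S :: "'p set"
    by (induction S rule: infinite_finite_induct) (auto simp: f(1) f0)
  define z where "z = (\<chi> j. f (u $ j))"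
  have "z \<noteq> 0" using f(4) by (auto simp: z_def vec_eq_iff)
  have tight: "z \<bullet> v = 0" if "(v, d) \<in> K" "u \<bullet> v = - d" for v d
  proof -
    have v: "v $ j \<in> \<rat>" for j using that K(2) by (auto simp: rational_points_def)
    have "z \<bullet> v = f (u \<bullet> v)"
      by (simp add: inner_vec_def z_def fsum f(2)[OF v, symmetric] mult.commute)
    also have "\<dots> = f ((- d) * 1)" using that by simp
    also have "\<dots> = 0" using that K(2) f(2)[of "- d" 1] f(3) by auto
    finally show ?thesis .
  qed
  have uK: "- d \<le> u \<bullet> v" if "(v, d) \<in> K" for v d
    using u that by (auto simp: extreme_point_of_def region_def)
  \<comment> \<open>Loose inequalities survive a small move along \<open>z\<close> and tight ones do
    not notice it, so for some \<open>t > 0\<close> both ends of a segment with midpoint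
    \<open>u\<close> lie in the region.\<close>
  have "\<forall>\<^sub>F t in at_right (0::real). \<forall>(v, d)\<in>K. - d \<le> (u + t *\<^sub>R z) \<bullet> v \<and> - d \<le> (u - t *\<^sub>R z) \<bullet> v"
  proof (rule eventually_ball_finite[OF K(1)], safe)
    fix v d assume vd: "(v, d) \<in> K"
    show "\<forall>\<^sub>F t in at_right (0::real). - d \<le> (u + t *\<^sub>R z) \<bullet> v \<and> - d \<le> (u - t *\<^sub>R z) \<bullet> v"
    proof (cases "u \<bullet> v = - d")
      case True
      then show ?thesis using tight[OF vd] by (simp add: inner_add_left inner_diff_left)
    next
      case False
      then have "- d < u \<bullet> v" using uK[OF vd] by simp
      moreover have "((\<lambda>t. (u + t *\<^sub>R z) \<bullet> v) \<longlongrightarrow> (u + 0 *\<^sub>R z) \<bullet> v) (at_right 0)"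
        "((\<lambda>t. (u - t *\<^sub>R z) \<bullet> v) \<longlongrightarrow> (u - 0 *\<^sub>R z) \<bullet> v) (at_right 0)"
        by (intro tendsto_intros)+
      ultimately have "\<forall>\<^sub>F t in at_right (0::real). - d < (u + t *\<^sub>R z) \<bullet> v"
        "\<forall>\<^sub>F t in at_right (0::real). - d < (u - t *\<^sub>R z) \<bullet> v"
        by (auto intro: order_tendstoD)
      then show ?thesis by eventually_elim auto
    qed
  qed
  moreover have "\<forall>\<^sub>F t in at_right (0::real). 0 < t" by (rule eventually_at_right_less)
  ultimately have "\<forall>\<^sub>F t in at_right (0::real). 0 < t \<and> u + t *\<^sub>R z \<in> region K \<and> u - t *\<^sub>R z \<in> region K"
    by eventually_elim (auto simp: region_def)
  then obtain t where t: "0 < t" "u + t *\<^sub>R z \<in> region K" "u - t *\<^sub>R z \<in> region K"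
    using eventually_happens'[OF trivial_limit_at_right_real] by blast
  have "u = midpoint (u + t *\<^sub>R z) (u - t *\<^sub>R z)" "u + t *\<^sub>R z \<noteq> u - t *\<^sub>R z"
    using \<open>z \<noteq> 0\<close> t(1) by (auto simp: midpoint_def scaleR_2[symmetric] algebra_simps)
  then have "u \<in> open_segment (u + t *\<^sub>R z) (u - t *\<^sub>R z)"
    by (metis midpoint_in_open_segment)
  with u t show False by (auto simp: extreme_point_of_def)
qed

text \<open>A bounded polyhedron is the hull of its finitely many extreme points, and these are
  rational.\<close>

lemma rational_polytope_region:
  fixes K :: "((real ^ 'p::finite) \<times> real) set"
  assumes "finite K" "K \<subseteq> rational_points \<times> \<rat>" "bounded (region K)" "region K \<noteq> {}"
  shows "rational_polytope (region K)"
proof -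
  note P = polyhedron_region[OF assms(1)]
  have eq: "region K = convex hull {x. x extreme_point_of region K}"
    using P assms(3) by (intro Krein_Milman_Minkowski)
      (auto simp: compact_eq_bounded_closed polyhedron_imp_closed polyhedron_imp_convex)
  show ?thesis unfolding rational_polytope_def
  proof (intro exI conjI)
    show "finite {x. x extreme_point_of region K}"
      by (rule finite_polyhedron_extreme_points[OF P])
    show "{x. x extreme_point_of region K} \<noteq> {}"
      using assms(4) eq by (metis convex_hull_empty)
  qed (use eq extreme_point_region_rational[OF assms(1,2)] in auto)
qed

section \<open>Mutations in \<open>N\<close> of polytopes with generators at heights
  \<open>-1\<close>, \<open>0\<close> and \<open>1\<close>\<close>

lemma half_sum_in_convex_hull:
  fixes V :: "'a::real_vector set"
  assumes "v \<in> V" "v' \<in> V"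
  shows "(1/2) *\<^sub>R (v + v') \<in> convex hull V"
  using convexD[OF convex_convex_hull, of v V v' "1/2" "1/2"] assms
  by (auto simp: hull_inc scaleR_add_right)

text \<open>
  A point of \<open>conv V\<close> at height \<open>0\<close> has equal total weight at the heights \<open>1\<close> and \<open>-1\<close>, so it is a
  combination of points of \<open>V\<close> at height \<open>0\<close> and of midpoints of points at the heights \<open>\<plusminus>1\<close>.
\<close>

lemma slice_zero_subset:
  fixes w :: "real ^ 'p::finite"
  assumes fin: "finite A" "finite B" "finite C"
    and h: "\<And>v. v \<in> A \<Longrightarrow> w \<bullet> v = -1" "\<And>v. v \<in> B \<Longrightarrow> w \<bullet> v = 0" "\<And>v. v \<in> C \<Longrightarrow> w \<bullet> v = 1"
    and S: "convex S" "B \<subseteq> S" "\<And>a c. a \<in> A \<Longrightarrow> c \<in> C \<Longrightarrow> (1/2) *\<^sub>R (a + c) \<in> S"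
  shows "slice w 0 (convex hull (A \<union> B \<union> C)) \<subseteq> S"
proof
  fix z assume z: "z \<in> slice w 0 (convex hull (A \<union> B \<union> C))"
  have disj: "A \<inter> B = {}" "(A \<union> B) \<inter> C = {}" using h by fastforce+
  obtain u where u: "\<forall>x\<in>A \<union> B \<union> C. 0 \<le> u x" "sum u (A \<union> B \<union> C) = 1"
    "(\<Sum>x\<in>A \<union> B \<union> C. u x *\<^sub>R x) = z"
    using z fin by (auto simp: slice_def convex_hull_finite)
  have split: "sum f (A \<union> B \<union> C) = sum f A + sum f B + sum f C" for f :: "_ \<Rightarrow> 'z::comm_monoid_add"
    using fin disj by (simp add: sum.union_disjoint)
  define s where "s = sum u A"
  have "0 = w \<bullet> z" using z by (simp add: slice_def)
  also have "\<dots> = (\<Sum>x\<in>A \<union> B \<union> C. u x * (w \<bullet> x))"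
    unfolding u(3)[symmetric] by (simp add: inner_sum_right)
  also have "\<dots> = - sum u A + sum u C"
    unfolding split by (simp add: h sum_negf)
  finally have sC: "sum u C = s" by (simp add: s_def)
  have sB: "sum u B = 1 - 2 * s"
    using u(2) sC unfolding split by (simp add: s_def)
  have s0: "0 \<le> s" unfolding s_def using u(1) by (auto intro: sum_nonneg)
  have pos: "0 \<le> u x" if "x \<in> A \<or> x \<in> B \<or> x \<in> C" for x using that u(1) by blast
  show "z \<in> S"
  proof (cases "s = 0")
    case True
    have "u x = 0" if "x \<in> A" for x
      using True that pos sum_nonneg_eq_0_iff[OF fin(1), of u] by (simp add: s_def)
    moreover have "u x = 0" if "x \<in> C" for x
      using True sC that pos sum_nonneg_eq_0_iff[OF fin(3), of u] by simp
    ultimately have "z = (\<Sum>x\<in>B. u x *\<^sub>R x)" using u(3) unfolding split by simp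
    moreover have "(\<Sum>x\<in>B. u x *\<^sub>R x) \<in> S"
      using True sB S(1,2) fin pos by (intro convex_sum) auto
    ultimately show ?thesis by simp
  next
    case False
    \<comment> \<open>Each pair of points of heights \<open>-1\<close> and \<open>1\<close> gets the
      product of its weights, divided by \<open>s^2\<close> to have total \<open>1\<close>. Summing
      out one member leaves the other weighted in proportion to \<open>u\<close>, so
      \<open>(2 * s) *\<^sub>R m\<close> is the part of \<open>z\<close> coming from nonzero
      heights.\<close>
    define m where "m = (\<Sum>(a, c)\<in>A \<times> C. (u a * u c / s\<^sup>2) *\<^sub>R ((1/2) *\<^sub>R (a + c)))"
    have "m = (\<Sum>p\<in>A \<times> C. (u (fst p) * u (snd p) / s\<^sup>2) *\<^sub>R ((1/2) *\<^sub>R (fst p + snd p)))"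
      by (simp add: m_def case_prod_unfold)
    also have "\<dots> \<in> S"
    proof (rule convex_sum)
      have "(\<Sum>p\<in>A \<times> C. u (fst p) * u (snd p) / s\<^sup>2) = (sum u A * sum u C) / s\<^sup>2"
        by (simp add: sum_product sum.cartesian_product case_prod_unfold sum_divide_distrib)
      also have "\<dots> = 1" using False sC by (simp add: s_def power2_eq_square)
      finally show "(\<Sum>p\<in>A \<times> C. u (fst p) * u (snd p) / s\<^sup>2) = 1" .
    qed (use fin S pos in \<open>auto intro!: divide_nonneg_nonneg mult_nonneg_nonneg\<close>)
    finally have mS: "m \<in> S" .
    have "m = (\<Sum>(a, c)\<in>A \<times> C. (1 / (2 * s\<^sup>2)) *\<^sub>R (u a * u c) *\<^sub>R (a + c))"
      unfolding m_def by (intro sum.cong) (auto simp: field_simps)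
    also have "\<dots> = (1 / (2 * s\<^sup>2)) *\<^sub>R (\<Sum>a\<in>A. \<Sum>c\<in>C. (u a * u c) *\<^sub>R (a + c))"
      by (simp only: sum.cartesian_product scaleR_sum_right case_prod_unfold)
    also have "(\<Sum>a\<in>A. \<Sum>c\<in>C. (u a * u c) *\<^sub>R (a + c)) =
      (\<Sum>a\<in>A. \<Sum>c\<in>C. (u a * u c) *\<^sub>R a) + (\<Sum>a\<in>A. \<Sum>c\<in>C. (u a * u c) *\<^sub>R c)"
      by (simp add: scaleR_add_right sum.distrib)
    also have "(\<Sum>a\<in>A. \<Sum>c\<in>C. (u a * u c) *\<^sub>R a) = s *\<^sub>R (\<Sum>a\<in>A. u a *\<^sub>R a)"
      by (simp add: scaleR_sum_left[symmetric] sum_distrib_left[symmetric] sC scaleR_sum_right mult.commute)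
    also have "(\<Sum>a\<in>A. \<Sum>c\<in>C. (u a * u c) *\<^sub>R c) = s *\<^sub>R (\<Sum>c\<in>C. u c *\<^sub>R c)"
      by (subst sum.swap) (simp add: scaleR_sum_left[symmetric] sum_distrib_right[symmetric]
          s_def[symmetric] scaleR_sum_right)
    finally have m: "(2 * s) *\<^sub>R m = (\<Sum>a\<in>A. u a *\<^sub>R a) + (\<Sum>c\<in>C. u c *\<^sub>R c)"
      using False by (simp add: power2_eq_square scaleR_add_right[symmetric])
    have z': "z = (2 * s) *\<^sub>R m + (\<Sum>x\<in>B. u x *\<^sub>R x)"
      using u(3) unfolding split m by (simp add: algebra_simps)
    have s1: "0 \<le> 1 - 2 * s" using sB pos by (metis sum_nonneg)
    show ?thesis
    proof (cases "1 - 2 * s = 0")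
      case True
      then have "u x = 0" if "x \<in> B" for x
        using sB that pos sum_nonneg_eq_0_iff[OF fin(2), of u] by simp
      then show ?thesis using z' mS True by simp
    next
      case F2: False
      define b where "b = (\<Sum>x\<in>B. (u x / (1 - 2 * s)) *\<^sub>R x)"
      have "b \<in> S"
        unfolding b_def using F2 s1 sB S(1,2) fin pos
        by (intro convex_sum) (auto simp: sum_divide_distrib[symmetric])
      moreover have "(1 - 2 * s) *\<^sub>R b = (\<Sum>x\<in>B. u x *\<^sub>R x)"
        using F2 by (simp add: b_def scaleR_sum_right)
      ultimately show ?thesis
        using convexD[OF S(1) mS, of b "2 * s" "1 - 2 * s"] s0 s1 z' by simp
    qed
  qed
qed

lemma lattice_points_diff: "x \<in> lattice_points \<Longrightarrow> y \<in> lattice_points \<Longrightarrow> x - y \<in> lattice_points"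
  by (simp add: lattice_points_def)

lemma lattice_points_add: "x \<in> lattice_points \<Longrightarrow> y \<in> lattice_points \<Longrightarrow> x + y \<in> lattice_points"
  by (simp add: lattice_points_def)

text \<open>The top slice is the hull of \<open>V1\<close>, which \<open>F\<close> moves to the hull
  of \<open>V1 + E\<close>. The middle slice is generated by \<open>V0\<close> and by midpoints of
  points at heights \<open>-1\<close> and \<open>1\<close>, and these midpoints stay in the new
  hull.\<close>

lemma mutation_N_convex_hull:
  fixes w :: "real ^ 'p::finite"
  assumes w: "primitive w"
    and E: "finite E" "E \<noteq> {}" "E \<subseteq> lattice_points" "\<And>f. f \<in> E \<Longrightarrow> w \<bullet> f = 0"
    and g: "g \<in> lattice_points" "w \<bullet> g = -1"
    and V0: "finite V0" "V0 \<subseteq> lattice_points" "\<And>v. v \<in> V0 \<Longrightarrow> w \<bullet> v = 0"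
    and V1: "finite V1" "V1 \<subseteq> lattice_points" "\<And>v. v \<in> V1 \<Longrightarrow> w \<bullet> v = 1"
  shows "mutation_N (convex hull ((+) g ` E \<union> V0 \<union> V1)) (convex hull ({g} \<union> V0 \<union> (V1 + E)))"
    (is "mutation_N (convex hull ?V) (convex hull ?V')")
proof -
  let ?P = "convex hull ?V" and ?F = "convex hull E"
  let ?G = "\<lambda>h::int. if h = -1 then {g} else {}"
  have finV: "finite ?V" using E V0 V1 by auto
  have Vlat: "?V \<subseteq> lattice_points" using E g V0 V1 by (auto intro: lattice_points_add)
  have Fperp: "?F \<subseteq> {v. w \<bullet> v = 0}"
    by (rule hull_minimal) (use E in \<open>auto intro: convex_hyperplane\<close>)
  have height: "w \<bullet> v \<in> {-1, 0, 1}" if "v \<in> ?V" for v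
    using that E g V0 V1 by (auto simp: inner_add_right)
  have "?P \<subseteq> {v. w \<bullet> v \<le> 1}"
    by (rule hull_minimal) (use height in \<open>force intro: convex_halfspace_le\<close>)+
  have extV: "v \<in> ?V" if "v extreme_point_of ?P" for v
    using that extreme_point_of_convex_hull by blast
  have lat: "lattice_polytope ?P"
    unfolding lattice_polytope_def using finV Vlat E(2) by (intro exI[of _ ?V]) auto
  have datum: "mutation_datum w ?F"
    unfolding mutation_datum_def lattice_polytope_def using w E Fperp by (intro conjI exI[of _ E]) auto
  have gF: "{g} + ?F \<subseteq> ?P"
  proof -
    have "{g} + ?F = (+) g ` ?F" by (auto simp: set_plus_def)
    also have "\<dots> = convex hull ((+) g ` E)" by (simp add: convex_hull_translation)
    also have "\<dots> \<subseteq> ?P" by (rule hull_mono) auto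
    finally show ?thesis .
  qed
  have wit: "mutation_witness w ?F ?P ?G"
    unfolding mutation_witness_def
  proof (intro allI impI conjI)
    fix h :: int assume "h < 0"
    show "?G h = {} \<or> lattice_polytope (?G h)"
      unfolding lattice_polytope_def using g(1) by (auto intro!: exI[of _ "{g}"])
    show "slice w h {v. v extreme_point_of ?P} \<subseteq> ?G h + (*\<^sub>R) (of_int \<bar>h\<bar>) ` ?F"
    proof
      fix v assume "v \<in> slice w h {v. v extreme_point_of ?P}"
      then have v: "v \<in> ?V" "w \<bullet> v = of_int h" using extV by (auto simp: slice_def)
      then have "h = -1" using height[OF v(1)] \<open>h < 0\<close> by auto
      then have "v \<in> (+) g ` E" using v V0(3) V1(3) by force
      then show "v \<in> ?G h + (*\<^sub>R) (of_int \<bar>h\<bar>) ` ?F"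
        using \<open>h = -1\<close> by (auto simp: set_plus_def hull_inc)
    qed
    show "?G h + (*\<^sub>R) (of_int \<bar>h\<bar>) ` ?F \<subseteq> slice w h ?P"
    proof (cases "h = -1")
      case True
      have "{g} + ?F \<subseteq> {v. w \<bullet> v = of_int h}"
        using Fperp g(2) True by (auto simp: set_plus_def inner_add_right)
      then show ?thesis using gF True by (auto simp: slice_def)
    qed (auto simp: set_plus_def)
  qed
  let ?X = "(\<Union>h\<in>{..-1}. ?G h) \<union> (\<Union>h\<in>{0..}. slice w h ?P + (*\<^sub>R) (of_int h) ` ?F)"
  have "convex hull ?V' = convex hull ?X"
  proof (rule antisym)
    show "convex hull ?V' \<subseteq> convex hull ?X"
    proof (rule hull_mono, rule Un_least, rule Un_least)
      show "{g} \<subseteq> ?X" by auto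
      show "V0 \<subseteq> ?X"
      proof
        fix v assume v: "v \<in> V0"
        then have "v \<in> slice w 0 ?P" using V0 by (auto simp: slice_def hull_inc)
        moreover have "0 \<in> (*\<^sub>R) (of_int 0) ` ?F" using E(2) by (force simp: image_iff)
        ultimately have "v + 0 \<in> slice w 0 ?P + (*\<^sub>R) (of_int 0) ` ?F" by (rule set_plus_intro)
        then show "v \<in> ?X" by (intro UnI2 UN_I[of 0]) auto
      qed
      show "V1 + E \<subseteq> ?X"
      proof
        fix x assume "x \<in> V1 + E"
        then obtain v f where x: "x = v + f" "v \<in> V1" "f \<in> E" by (auto simp: set_plus_def)
        then have "v \<in> slice w 1 ?P" "f \<in> (*\<^sub>R) (of_int 1) ` ?F"
          using V1 by (auto simp: slice_def hull_inc)
        then have "x \<in> slice w 1 ?P + (*\<^sub>R) (of_int 1) ` ?F" using x by (auto intro: set_plus_intro)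
        then show "x \<in> ?X" by (intro UnI2 UN_I[of 1]) auto
      qed
    qed
    have "?X \<subseteq> convex hull ?V'"
    proof
      fix x assume "x \<in> ?X"
      then consider "x = g" | h where "h \<ge> 0" "x \<in> slice w h ?P + (*\<^sub>R) (of_int h) ` ?F"
        by (auto split: if_splits)
      then show "x \<in> convex hull ?V'"
      proof cases
        case 1
        then show ?thesis by (simp add: hull_inc)
      next
        case 2
        then obtain y f where y: "y \<in> slice w h ?P" "f \<in> ?F" "x = y + of_int h *\<^sub>R f"
          by (auto simp: set_plus_def)
        have "h \<le> 1" using y(1) \<open>?P \<subseteq> {v. w \<bullet> v \<le> 1}\<close> by (auto simp: slice_def)
        then consider "h = 0" | "h = 1" using 2(1) by linarith
        then show ?thesis
        proof cases
          case 1
          have "slice w 0 ?P \<subseteq> convex hull ?V'"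
          proof (rule slice_zero_subset)
            fix a c assume "a \<in> (+) g ` E" "c \<in> V1"
            then obtain f where f: "a = g + f" "f \<in> E" "c \<in> V1" by blast
            \<comment> \<open>The midpoint of \<open>g + f\<close> and \<open>c\<close> is also that
              of \<open>g\<close> and \<open>c + f\<close>, both generators after the
              mutation.\<close>
            then have "(1/2) *\<^sub>R (g + (c + f)) \<in> convex hull ?V'"
              by (intro half_sum_in_convex_hull) (auto intro: set_plus_intro)
            then show "(1/2) *\<^sub>R (a + c) \<in> convex hull ?V'" by (simp add: f(1) add_ac)
          qed (use E V0 V1 g in \<open>auto simp: inner_add_right hull_inc\<close>)
          then show ?thesis using y 1 by auto
        next
          case 2
          have "y \<in> ?P \<inter> {v. w \<bullet> v = 1}" using y(1) 2 by (auto simp: slice_def)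
          \<comment> \<open>Height \<open>1\<close> is the maximum on the generators, so a
            combination reaching it puts weight only on generators of that height.\<close>
          also have "\<dots> \<subseteq> convex hull V1"
          proof
            fix z assume z: "z \<in> ?P \<inter> {v. w \<bullet> v = 1}"
            obtain u where u: "\<forall>x\<in>?V. 0 \<le> u x" "sum u ?V = 1" "(\<Sum>x\<in>?V. u x *\<^sub>R x) = z"
              using z finV by (auto simp: convex_hull_finite)
            have "(\<Sum>x\<in>?V. u x * (1 - w \<bullet> x)) = 1 - w \<bullet> z"
              unfolding u(3)[symmetric] using u(2)
              by (simp add: right_diff_distrib sum_subtractf inner_sum_right)
            also have "\<dots> = 0" using z by simp
            finally have sum0: "(\<Sum>x\<in>?V. u x * (1 - w \<bullet> x)) = 0" .
            have nonneg: "0 \<le> u x * (1 - w \<bullet> x)" if "x \<in> ?V" for x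
            proof (rule mult_nonneg_nonneg)
              show "0 \<le> u x" using u(1) that by blast
              show "0 \<le> 1 - w \<bullet> x" using height[OF that] by auto
            qed
            have prod0: "u x * (1 - w \<bullet> x) = 0" if "x \<in> ?V" for x
              using sum_nonneg_0[OF finV nonneg sum0 that] .
            have "1 - w \<bullet> x \<noteq> 0" if "x \<in> ?V - V1" for x
              using that E(4) g(2) V0(3) by (auto simp: inner_add_right)
            then have 0: "\<forall>x\<in>?V - V1. u x = 0" using prod0 by (metis DiffD1 mult_eq_0_iff)
            have "sum u V1 = 1" "(\<Sum>x\<in>V1. u x *\<^sub>R x) = z"
              unfolding u(2,3)[symmetric] using finV 0
              by (auto intro!: sum.mono_neutral_left)
            then show "z \<in> convex hull V1" using u(1) V1(1) by (auto simp: convex_hull_finite)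
          qed
          finally have "x \<in> convex hull V1 + ?F" using y 2 by (auto intro: set_plus_intro)
          also have "\<dots> = convex hull (V1 + E)" by (simp add: convex_hull_set_plus)
          also have "\<dots> \<subseteq> convex hull ?V'" by (rule hull_mono) auto
          finally show ?thesis .
        qed
      qed
    qed
    then show "convex hull ?X \<subseteq> convex hull ?V'" by (simp add: hull_minimal)
  qed
  then show ?thesis
    unfolding mutation_N_def using lat datum wit by blast
qed

section \<open>Duals\<close>

lemma inner_lattice_points: "x \<in> lattice_points \<Longrightarrow> y \<in> lattice_points \<Longrightarrow> x \<bullet> y \<in> \<int>"
  by (auto simp: inner_vec_def lattice_points_def intro!: Ints_sum Ints_mult)

text \<open>Otherwise arbitrarily large multiples of \<open>z\<close> would lie in the
  region.\<close>

lemma recession_eq_0: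
  fixes z :: "real ^ 'p::finite"
  assumes "bounded (region (V \<times> {1}))" "\<And>v. v \<in> V \<Longrightarrow> 0 \<le> z \<bullet> v"
  shows "z = 0"
proof (rule ccontr)
  assume "z \<noteq> 0"
  obtain B where B: "\<And>x. x \<in> region (V \<times> {1}) \<Longrightarrow> norm x \<le> B"
    using assms(1) by (auto simp: bounded_iff)
  have "((\<bar>B\<bar> + 1) / norm z) *\<^sub>R z \<in> region (V \<times> {1})"
    using assms(2) by (fastforce simp: region_def intro: order_trans[of "-1" 0])
  from B[OF this] show False using \<open>z \<noteq> 0\<close> by simp
qed

text \<open>A bipolar theorem, with boundedness in place of the condition that the hull contains
  \<open>0\<close>. A functional \<open>a\<close> separating \<open>z\<close> from the hull is
  either a recession direction, hence \<open>0\<close>, or rescales to a point of the region at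
  which \<open>z\<close> fails.\<close>

lemma polar_region:
  fixes V :: "(real ^ 'p::finite) set"
  assumes V: "finite V" "V \<noteq> {}" and bdd: "bounded (region (V \<times> {1}))"
  shows "{v. \<forall>y\<in>region (V \<times> {1}). y \<bullet> v \<ge> -1} = convex hull V" (is "?L = _")
proof
  have "?L = (\<Inter>y\<in>region (V \<times> {1}). {v. y \<bullet> v \<ge> -1})" by auto
  also have "convex \<dots>" by (intro convex_INT convex_halfspace_ge)
  finally have "convex ?L" .
  then show "convex hull V \<subseteq> ?L"
    by (intro hull_minimal) (auto simp: region_def)
  show "?L \<subseteq> convex hull V"
  proof (rule subsetI, rule ccontr)
    fix z assume z: "z \<in> ?L" "z \<notin> convex hull V"
    have "closed (convex hull V)"
      using V(1) by (intro compact_imp_closed compact_convex_hull finite_imp_compact)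
    then obtain a b where ab: "a \<bullet> z < b" "\<And>x. x \<in> convex hull V \<Longrightarrow> a \<bullet> x > b"
      using separating_hyperplane_closed_point[OF convex_convex_hull _ z(2)] by metis
    have aV: "a \<bullet> v > b" if "v \<in> V" for v using ab(2) that by (simp add: hull_inc)
    show False
    proof (cases "b \<ge> 0")
      case True
      have "a = 0" using recession_eq_0[OF bdd, of a] aV True by force
      then show False using aV V(2) True by auto
    next
      case False
      have "(1 / (- b)) *\<^sub>R a \<in> region (V \<times> {1})"
        using False aV by (force simp: region_def field_simps)
      then have "(1 / (- b)) *\<^sub>R a \<bullet> z \<ge> -1" using z(1) by blast
      then show False using ab(1) False by (simp add: field_simps)
    qed
  qed
qed

text \<open>At an interior point the pairing with a nonzero normal is strictly above
  \<open>-1\<close>, so at a lattice point it is nonnegative by integrality, and boundedness leaves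
  only \<open>0\<close>.\<close>

lemma interior_lattice_points_region:
  fixes V :: "(real ^ 'p::finite) set"
  assumes V: "finite V" "V \<subseteq> lattice_points" and bdd: "bounded (region (V \<times> {1}))"
  shows "interior (region (V \<times> {1})) \<inter> lattice_points = {0}"
proof (intro equalityI subsetI)
  fix z assume z: "z \<in> interior (region (V \<times> {1})) \<inter> lattice_points"
  obtain e where e: "e > 0" "cball z e \<subseteq> region (V \<times> {1})"
    using z mem_interior_cball by blast
  have "0 \<le> z \<bullet> v" if v: "v \<in> V" for v
  proof (cases "v = 0")
    case False
    have "z - (e / norm v) *\<^sub>R v \<in> cball z e" using e(1) False by (simp add: dist_norm)
    then have "z - (e / norm v) *\<^sub>R v \<in> region (V \<times> {1})" using e(2) by blast
    then have "-1 \<le> (z - (e / norm v) *\<^sub>R v) \<bullet> v" using v by (auto simp: region_def)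
    moreover have "0 < (e / norm v) * (v \<bullet> v)" using e(1) False by simp
    ultimately have "-1 < z \<bullet> v" by (simp add: inner_diff_left)
    moreover obtain k where "z \<bullet> v = of_int k"
      using inner_lattice_points[of z v] z v V(2) by (auto elim: Ints_cases)
    ultimately show ?thesis by simp
  qed simp
  then show "z \<in> {0}" using recession_eq_0[OF bdd] by blast
next
  fix z :: "real ^ 'p" assume "z \<in> {0}"
  then have [simp]: "z = 0" by simp
  have "open (\<Inter>v\<in>V. {y. v \<bullet> y > -1})"
    using V(1) by (intro open_INT) (auto intro: open_halfspace_gt)
  moreover have "0 \<in> (\<Inter>v\<in>V. {y. v \<bullet> y > -1})" by simp
  moreover have "(\<Inter>v\<in>V. {y. v \<bullet> y > -1}) \<subseteq> region (V \<times> {1})"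
    by (force simp: region_def inner_commute)
  ultimately have "0 \<in> interior (region (V \<times> {1}))" by (meson interior_maximal subsetD)
  then show "z \<in> interior (region (V \<times> {1})) \<inter> lattice_points"
    by (simp add: lattice_points_def)
qed

text \<open>The translation is absorbed: \<open>a\<close> becomes the unique interior lattice point,
  which \<open>dual\<close> subtracts again.\<close>

lemma dual_translated_region:
  fixes V :: "(real ^ 'p::finite) set"
  assumes V: "finite V" "V \<noteq> {}" "V \<subseteq> lattice_points" and bdd: "bounded (region (V \<times> {1}))"
    and a: "a \<in> lattice_points"
  shows "dual ((+) a ` region (V \<times> {1})) = convex hull V"
proof -
  let ?Q = "region (V \<times> {1})"
  have "(THE z. z \<in> interior ((+) a ` ?Q) \<and> z \<in> lattice_points) = a"
  proof (rule the_equality)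
    have "0 \<in> interior ?Q" using interior_lattice_points_region[OF V(1,3) bdd] by blast
    then show "a \<in> interior ((+) a ` ?Q) \<and> a \<in> lattice_points"
      using a by (force simp: interior_translation)
  next
    fix z assume z: "z \<in> interior ((+) a ` ?Q) \<and> z \<in> lattice_points"
    then have "z - a \<in> interior ?Q \<inter> lattice_points"
      using a by (auto simp: interior_translation intro: lattice_points_diff)
    then show "z = a" using interior_lattice_points_region[OF V(1,3) bdd] by auto
  qed
  then show ?thesis
    unfolding dual_def by (simp add: polar_region[OF V(1,2) bdd])
qed

section \<open>Marked order and chain polytopes\<close>

lemma axis_lattice: "axis p (1::real) \<in> lattice_points"
  by (simp add: lattice_points_def axis_def)

lemma sum_list_axis_component: "p \<notin> set ps \<Longrightarrow> (\<Sum>p\<leftarrow>ps. axis p (1::real)) $ p = 0"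
  by (induction ps) (auto simp: axis_def)

lemma sum_list_axis_lattice: "(\<Sum>p\<leftarrow>ps. axis p (1::real)) \<in> lattice_points"
  by (induction ps) (auto simp: lattice_points_def axis_def)

lemma inner_sum_list_axis: "(y :: real ^ 'p::finite) \<bullet> (\<Sum>p\<leftarrow>ps. axis p 1) = (\<Sum>p\<leftarrow>ps. y $ p)"
  by (induction ps) (auto simp: inner_add_right inner_axis)

lemma primitive_minus_axis: "primitive (- axis p (1::real) :: real ^ 'p::finite)"
  unfolding primitive_def
proof (intro conjI allI ballI impI)
  show "- axis p (1::real) \<in> lattice_points" by (simp add: lattice_points_def axis_def)
  show "- axis p (1::real) \<noteq> 0" by (simp add: axis_eq_0_iff)
  fix k :: int and u :: "real ^ 'p" assume u: "u \<in> lattice_points" "- axis p 1 = of_int k *\<^sub>R u"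
  obtain m where m: "u $ p = of_int m" using u(1) by (auto simp: lattice_points_def elim: Ints_cases)
  have "(- axis p 1 :: real ^ 'p) $ p = of_int k * u $ p" using u(2) by simp
  then have "real_of_int (k * m) = - 1" by (simp add: m)
  then have "k * m = - 1" by linarith
  then show "\<bar>k\<bar> = 1" by (metis abs_zmult_eq_1 abs_minus abs_one)
qed

text \<open>
  \<open>cov q p\<close> means that \<open>p\<close> covers \<open>q\<close>; \<open>emb\<close> enumerates the unmarked elements, \<open>A\<close> is the set of
  marked ones. On \<open>A\<close>, \<open>c\<close> is the marking; on the unmarked elements it is the point which becomes the
  origin. As \<open>c\<close> does not distinguish between the lower covers of an element, the maximum over
  lower covers becomes positively homogeneous after this translation.
\<close>

locale marked_poset =
  fixes cov :: "'a \<Rightarrow> 'a \<Rightarrow> bool" and emb :: "'p::finite \<Rightarrow> 'a" and A :: "'a set"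
    and c :: "'a \<Rightarrow> real" and rank :: "'a \<Rightarrow> nat"
  assumes inj_emb: "inj emb"
    and finite_A: "finite A"
    and A_emb: "A \<inter> range emb = {}"
    and cov_field: "cov q p \<Longrightarrow> q \<in> A \<union> range emb \<and> p \<in> A \<union> range emb"
    and cov_marked: "cov q p \<Longrightarrow> p \<in> A \<Longrightarrow> q \<notin> A"
    and rank_less: "cov q p \<Longrightarrow> rank q < rank p"
    and ex_lower: "\<exists>q. cov q (emb i)"
    and ex_upper: "\<exists>q. cov (emb i) q"
    and balanced: "cov q p \<Longrightarrow> cov q' p \<Longrightarrow> c q = c q'"
    and c_int: "c p \<in> \<int>"
begin

definition order_polytope :: "(real ^ 'p) set" where
  "order_polytope =
     {u. (\<forall>p q. cov\<^sup>+\<^sup>+ (emb p) (emb q) \<longrightarrow> u $ p \<le> u $ q) \<and>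
         (\<forall>a\<in>A. \<forall>p. (cov\<^sup>+\<^sup>+ a (emb p) \<longrightarrow> c a \<le> u $ p) \<and> (cov\<^sup>+\<^sup>+ (emb p) a \<longrightarrow> u $ p \<le> c a))}"

definition chain_polytope :: "(real ^ 'p) set" where
  "chain_polytope =
     {u. (\<forall>p. 0 \<le> u $ p) \<and>
         (\<forall>a\<in>A. \<forall>b\<in>A. \<forall>ps. ps \<noteq> [] \<and> sorted_wrt (cov\<^sup>+\<^sup>+) (a # map emb ps @ [b]) \<longrightarrow>
            (\<Sum>p\<leftarrow>ps. u $ p) \<le> c b - c a)}"

text \<open>By \<open>balanced\<close> the choice of the lower cover is immaterial. In centred
  coordinates this is the common constant of all inequalities between \<open>p\<close> and its lower
  covers.\<close>

definition r :: "'a \<Rightarrow> real" where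
  "r p = c p - c (SOME q. cov q p)"

lemma r_eq: "cov q p \<Longrightarrow> r p = c p - c q"
  unfolding r_def using balanced by (metis someI)

lemma r_int: "r p \<in> \<int>"
  unfolding r_def using c_int by simp

text \<open>With \<open>0\<close> at marked elements, the single formula
  \<open>axis p 1 - e q\<close> serves for a lower cover \<open>q\<close> that is a coordinate and
  for one that is a mark.\<close>

definition e :: "'a \<Rightarrow> real ^ 'p" where
  "e x = (if x \<in> range emb then axis (inv emb x) 1 else 0)"

lemma e_emb [simp]: "e (emb i) = axis i 1"
  by (simp add: e_def inj_emb)

lemma e_marked: "a \<in> A \<Longrightarrow> e a = 0"
  using A_emb by (auto simp: e_def)

lemma e_lattice: "e x \<in> lattice_points"
  by (auto simp: e_def lattice_points_def axis_def)

lemma e_component: "x \<noteq> emb i \<Longrightarrow> e x $ i = 0"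
  by (auto simp: e_def axis_def inj_emb)

lemma cov_neq: "cov q p \<Longrightarrow> q \<noteq> p"
  using rank_less by blast

lemma finite_lower: "finite {q. cov q p}"
  by (rule finite_subset[of _ "A \<union> range emb"]) (use cov_field finite_A in auto)

text \<open>Undoes the centring: the original coordinates on unmarked elements and the marks on
  \<open>A\<close>, as one function on the poset.\<close>

definition ext :: "real ^ 'p \<Rightarrow> 'a \<Rightarrow> real" where
  "ext x p = x \<bullet> e p + c p"

lemma ext_marked: "a \<in> A \<Longrightarrow> ext x a = c a"
  by (simp add: ext_def e_marked)

lemma ext_mono:
  assumes "\<And>q p. cov q p \<Longrightarrow> ext x q \<le> ext x p"
  shows "cov\<^sup>+\<^sup>+ q p \<Longrightarrow> ext x q \<le> ext x p"
  by (induction rule: tranclp_induct) (use assms in \<open>auto intro: order_trans\<close>)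

text \<open>
  \<open>C\<close> is the set of elements transferred so far. A triple \<open>(v, q, d)\<close> in \<open>W\<close> stands for the
  saturated chains through \<open>C\<close> from a marked element down to \<open>q \<notin> C\<close>; it encodes the inequality
  \<open>- d \<le> \<langle>y, v - e q\<rangle>\<close>.
\<close>

inductive stage :: "'p set \<Rightarrow> ((real ^ 'p) \<times> 'a \<times> real) set \<Rightarrow> bool" where
  init: "stage {} {(0, q, r b) | q b. b \<in> A \<and> cov q b}"
| step: "\<lbrakk>stage C W; p \<notin> C; \<And>p'. cov (emb p) (emb p') \<Longrightarrow> p' \<in> C\<rbrakk> \<Longrightarrow>
    stage (insert p C) ({(v, q, d) \<in> W. q \<noteq> emb p} \<union>
      (\<lambda>((v, q', d), q). (v - axis p 1, q, d)) ` ({(v, q, d) \<in> W. q = emb p} \<times> {q. cov q (emb p)}))"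

text \<open>The three families are the positivity of transferred coordinates, the covering relations
  below untransferred elements, and the inequalities of chains descending from marked
  elements.\<close>

definition constraints :: "'p set \<Rightarrow> ((real ^ 'p) \<times> 'a \<times> real) set \<Rightarrow> ((real ^ 'p) \<times> real) set" where
  "constraints C W =
     (\<lambda>p. (axis p 1, r (emb p))) ` C \<union>
     {(axis p 1 - e q, r (emb p)) | p q. p \<notin> C \<and> cov q (emb p)} \<union>
     (\<lambda>(v, q, d). (v - e q, d)) ` W"

abbreviation init_constraints :: "((real ^ 'p) \<times> real) set" where
  "init_constraints \<equiv> constraints {} {(0, q, r b) | q b. b \<in> A \<and> cov q b}"

section \<open>Invariants of the stages\<close>

lemma stage_upward_closed: "stage C W \<Longrightarrow> p \<in> C \<Longrightarrow> cov (emb p) (emb p') \<Longrightarrow> p' \<in> C"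
  by (induction rule: stage.induct) auto

lemma stage_finite: "stage C W \<Longrightarrow> finite W"
proof (induction rule: stage.induct)
  case init
  have eq: "{(0, q, r b) | q b. b \<in> A \<and> cov q b} = (\<lambda>(b, q). (0, q, r b)) ` (SIGMA b:A. {q. cov q b})"
    by auto
  show ?case unfolding eq by (intro finite_imageI finite_SigmaI finite_A finite_lower)
next
  case (step C W p)
  have "finite {(v, q, d) \<in> W. q \<noteq> emb p}" "finite {(v, q, d) \<in> W. q = emb p}"
    by (rule finite_subset[OF _ step.IH]; auto)+
  then show ?case using finite_lower by blast
qed

text \<open>\<open>ps\<close> lists the chain upwards from \<open>q\<close> to \<open>b\<close>.
  That \<open>d\<close> is the difference of \<open>c\<close> along one cover gives its integrality,
  and its value \<open>1\<close> for \<open>2 * rho\<close>; the telescoped last equation turns the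
  constant into \<open>c b - c q\<close> once the centring is undone.\<close>

definition chain_triple :: "'p set \<Rightarrow> real ^ 'p \<Rightarrow> 'a \<Rightarrow> real \<Rightarrow> bool" where
  "chain_triple C v q d \<longleftrightarrow> q \<in> A \<union> range emb \<and> q \<notin> emb ` C \<and>
     (\<exists>ps b q0. b \<in> A \<and> cov q0 b \<and> d = c b - c q0 \<and> set ps \<subseteq> C \<and>
        v = - (\<Sum>p\<leftarrow>ps. axis p 1) \<and> sorted_wrt (cov\<^sup>+\<^sup>+) (q # map emb ps @ [b]) \<and>
        (ps = [] \<longrightarrow> q \<in> range emb) \<and> d + (\<Sum>p\<leftarrow>ps. r (emb p)) + c q = c b)"

lemma chain_tripleI:
  assumes "q \<in> A \<union> range emb" "q \<notin> emb ` C" "b \<in> A" "cov q0 b" "d = c b - c q0" "set ps \<subseteq> C"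
    "v = - (\<Sum>p\<leftarrow>ps. axis p 1)" "sorted_wrt (cov\<^sup>+\<^sup>+) (q # map emb ps @ [b])"
    "ps = [] \<Longrightarrow> q \<in> range emb" "d + (\<Sum>p\<leftarrow>ps. r (emb p)) + c q = c b"
  shows "chain_triple C v q d"
  using assms unfolding chain_triple_def by blast

lemma stage_chain_triple: "stage C W \<Longrightarrow> (v, q, d) \<in> W \<Longrightarrow> chain_triple C v q d"
proof (induction arbitrary: v q d rule: stage.induct)
  case init
  then obtain b where b: "v = 0" "d = r b" "b \<in> A" "cov q b" by auto
  then have "q \<in> range emb" using cov_field cov_marked by blast
  with b show ?case
    by (intro chain_tripleI[where ps = "[]" and b = b and ?q0.0 = q]) (auto simp: r_eq)
next
  case (step C W p)
  consider "(v, q, d) \<in> W" "q \<noteq> emb p"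
    | v' where "(v', emb p, d) \<in> W" "v = v' - axis p 1" "cov q (emb p)"
    using step.prems by auto
  then show ?case
  proof cases
    case 1
    then show ?thesis using step.IH[OF 1(1)] unfolding chain_triple_def by blast
  next
    case 2
    obtain ps b q0 where ps: "b \<in> A" "cov q0 b" "d = c b - c q0" "set ps \<subseteq> C"
      "v' = - (\<Sum>p\<leftarrow>ps. axis p 1)" "sorted_wrt (cov\<^sup>+\<^sup>+) (emb p # map emb ps @ [b])"
      "d + (\<Sum>p\<leftarrow>ps. r (emb p)) + c (emb p) = c b"
      using step.IH[OF 2(1)] unfolding chain_triple_def by blast
    \<comment> \<open>Stages are upward closed, so a transferred \<open>q\<close> would force the
      element \<open>p\<close> above it into \<open>C\<close>.\<close>
    have "q \<notin> emb ` insert p C"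
    proof
      assume "q \<in> emb ` insert p C"
      then obtain i where i: "q = emb i" "i = p \<or> i \<in> C" by blast
      then have "p \<in> C" using stage_upward_closed[OF step.hyps(1)] 2(3) cov_neq by blast
      with step.hyps show False by blast
    qed
    moreover have "sorted_wrt (cov\<^sup>+\<^sup>+) (q # map emb (p # ps) @ [b])"
      using ps(6) 2(3) by (auto intro: tranclp_into_tranclp2)
    moreover have "q \<in> A \<union> range emb" using cov_field 2(3) by blast
    ultimately show ?thesis
      using ps 2 r_eq[OF 2(3)]
      by (intro chain_tripleI[where ps = "p # ps" and b = b and ?q0.0 = q0]) auto
  qed
qed

text \<open>The chains run through transferred elements only, so the height of such a normal in a
  later step is decided by the end \<open>q\<close>.\<close>

lemma stage_component: "stage C W \<Longrightarrow> (v, q, d) \<in> W \<Longrightarrow> p \<notin> C \<Longrightarrow> v $ p = 0"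
  using stage_chain_triple[of C W v q d] sum_list_axis_component
  unfolding chain_triple_def by fastforce

lemma stage_lattice: "stage C W \<Longrightarrow> (v, q, d) \<in> W \<Longrightarrow> v \<in> lattice_points"
  using stage_chain_triple[of C W v q d] lattice_points_diff[of 0 "sum_list _"] sum_list_axis_lattice
  unfolding chain_triple_def by (fastforce simp: lattice_points_def)

lemma constraints_finite: "stage C W \<Longrightarrow> finite (constraints C W)"
proof -
  assume "stage C W"
  have "{(axis p 1 - e q, r (emb p)) | p q. p \<notin> C \<and> cov q (emb p)} =
    (\<lambda>(p, q). (axis p 1 - e q, r (emb p))) ` (SIGMA p:-C. {q. cov q (emb p)})"
    by auto
  then show ?thesis
    using stage_finite[OF \<open>stage C W\<close>] finite_lower by (simp add: constraints_def)
qed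

lemma constraints_integral:
  assumes "stage C W"
  shows "constraints C W \<subseteq> lattice_points \<times> \<int>"
proof -
  have "d \<in> \<int>" if "(v, q, d) \<in> W" for v q d
    using stage_chain_triple[OF assms that] c_int by (auto simp: chain_triple_def)
  then show ?thesis
    unfolding constraints_def using stage_lattice[OF assms] e_lattice axis_lattice r_int
    by (auto intro!: lattice_points_diff)
qed

text \<open>Brings a step into the shape of \<open>trop_map_region\<close>, heights being negated
  \<open>p\<close>-coordinates: covering relations below \<open>p\<close> have height
  \<open>-1\<close>, chains ending at \<open>p\<close> have height \<open>1\<close>, and all other
  normals avoid the coordinate \<open>p\<close>.\<close>

lemma constraints_step:
  fixes p :: 'p
  defines "w \<equiv> - axis p (1::real)" and "E \<equiv> (\<lambda>q. - e q) ` {q. cov q (emb p)}"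
  assumes st: "stage C W" and p: "p \<notin> C" "\<And>p'. cov (emb p) (emb p') \<Longrightarrow> p' \<in> C"
    and W': "W' = {(v, q, d) \<in> W. q \<noteq> emb p} \<union>
      (\<lambda>((v, q', d), q). (v - axis p 1, q, d)) ` ({(v, q, d) \<in> W. q = emb p} \<times> {q. cov q (emb p)})"
  obtains K0 K1 where
    "constraints C W = (\<lambda>f. (axis p 1 + f, r (emb p))) ` E \<union> K0 \<union> K1"
    "constraints (insert p C) W' =
      {(axis p 1, r (emb p))} \<union> K0 \<union> (\<lambda>((v, d), f). (v + f, d)) ` (K1 \<times> E)"
    "\<And>v d. (v, d) \<in> K0 \<Longrightarrow> w \<bullet> v = 0" "\<And>v d. (v, d) \<in> K1 \<Longrightarrow> w \<bullet> v = 1"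
    "finite E" "E \<noteq> {}" "E \<subseteq> lattice_points" "\<And>f. f \<in> E \<Longrightarrow> w \<bullet> f = 0"
proof
  let ?K0 = "(\<lambda>p. (axis p 1, r (emb p))) ` C \<union>
     {(axis p' 1 - e q, r (emb p')) | p' q. p' \<notin> insert p C \<and> cov q (emb p')} \<union>
     (\<lambda>(v, q, d). (v - e q, d)) ` {(v, q, d) \<in> W. q \<noteq> emb p}"
  let ?K1 = "(\<lambda>(v, q, d). (v - e q, d)) ` {(v, q, d) \<in> W. q = emb p}"
  have w: "w \<bullet> v = - v $ p" for v by (simp add: w_def inner_axis')
  have "(\<lambda>f. (axis p 1 + f, r (emb p))) ` E = {(axis p 1 - e q, r (emb p)) | q. cov q (emb p)}"
    by (auto simp: E_def image_image)
  then have "{(axis p' 1 - e q, r (emb p')) | p' q. p' \<notin> C \<and> cov q (emb p')} =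
    (\<lambda>f. (axis p 1 + f, r (emb p))) ` E \<union>
    {(axis p' 1 - e q, r (emb p')) | p' q. p' \<notin> insert p C \<and> cov q (emb p')}"
    using p(1) by blast
  moreover have "W = {(v, q, d) \<in> W. q \<noteq> emb p} \<union> {(v, q, d) \<in> W. q = emb p}" by auto
  then have "(\<lambda>(v, q, d). (v - e q, d)) ` W =
    (\<lambda>(v, q, d). (v - e q, d)) ` {(v, q, d) \<in> W. q \<noteq> emb p} \<union> ?K1"
    by (metis image_Un)
  ultimately show "constraints C W = (\<lambda>f. (axis p 1 + f, r (emb p))) ` E \<union> ?K0 \<union> ?K1"
    unfolding constraints_def by (simp only: Un_ac)
  have "(\<lambda>(v, q, d). (v - e q, d)) ` (\<lambda>((v, q', d), q). (v - axis p 1, q, d)) `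
      ({(v, q, d) \<in> W. q = emb p} \<times> {q. cov q (emb p)}) = (\<lambda>((v, d), f). (v + f, d)) ` (?K1 \<times> E)"
    unfolding E_def by (force simp: image_iff)
  then show "constraints (insert p C) W' =
      {(axis p 1, r (emb p))} \<union> ?K0 \<union> (\<lambda>((v, d), f). (v + f, d)) ` (?K1 \<times> E)"
    unfolding constraints_def W' by (simp only: image_Un image_insert Un_ac Un_insert_left Un_insert_right Un_empty_left Un_empty_right)
  have "(axis p' 1 - e q) $ p = 0" if "p' \<notin> insert p C" "cov q (emb p')" for p' q
  proof -
    \<comment> \<open>All unmarked upper covers of \<open>p\<close> are in \<open>C\<close>, so
      \<open>p\<close> is not a lower cover of the untransferred \<open>p'\<close>.\<close>
    have "q \<noteq> emb p" using that p(2) by blast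
    then show ?thesis using that by (auto simp: axis_def e_component)
  qed
  moreover have "axis p' (1::real) $ p = 0" if "p' \<in> C" for p' using that p(1) by (auto simp: axis_def)
  moreover have "(v - e q) $ p = 0" if "(v, q, d) \<in> W" "q \<noteq> emb p" for v q d
    using stage_component[OF st that(1) p(1)] that(2) by (simp add: e_component)
  ultimately show "w \<bullet> v = 0" if "(v, d) \<in> ?K0" for v d
    using that unfolding w by auto
  show "w \<bullet> v = 1" if "(v, d) \<in> ?K1" for v d
    using that stage_component[OF st _ p(1)] unfolding w by (auto simp: axis_def)
  show "finite E" "E \<noteq> {}" using finite_lower ex_lower by (auto simp: E_def)
  show "E \<subseteq> lattice_points" using e_lattice by (auto simp: E_def lattice_points_def)
  show "w \<bullet> f = 0" if "f \<in> E" for f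
    using that e_component cov_neq unfolding E_def w by auto
qed

text \<open>Boundedness and nonemptiness travel along the tropical maps. Together with the integral
  inequalities they make every intermediate image a rational polytope, as \<open>mutation_M\<close>
  demands.\<close>

lemma stage_region:
  assumes "stage C W"
    and bdd: "bounded (region init_constraints)" and ne: "region init_constraints \<noteq> {}"
  shows "bounded (region (constraints C W)) \<and> region (constraints C W) \<noteq> {} \<and>
    rational_polytope (region (constraints C W)) \<and>
    mutation_M\<^sup>*\<^sup>* (region init_constraints) (region (constraints C W))"
proof -
  have rat: "rational_polytope (region (constraints C W))"
    if "stage C W" "bounded (region (constraints C W))" "region (constraints C W) \<noteq> {}" for C W
    using rational_polytope_region[OF constraints_finite[OF that(1)] _ that(2,3)] constraints_integral[OF that(1)]
    by (force simp: lattice_points_def rational_points_def dest: subsetD[OF Ints_subset_Rats])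
  show ?thesis using assms(1)
  proof induction
    case init
    then show ?case using bdd ne rat[OF stage.init] by simp
  next
    case (step C W p)
    let ?W' = "{(v, q, d) \<in> W. q \<noteq> emb p} \<union>
      (\<lambda>((v, q', d), q). (v - axis p 1, q, d)) ` ({(v, q, d) \<in> W. q = emb p} \<times> {q. cov q (emb p)})"
    let ?w = "- axis p (1::real)" and ?E = "(\<lambda>q. - e q) ` {q. cov q (emb p)}"
    obtain K0 K1 where K:
      "constraints C W = (\<lambda>f. (axis p 1 + f, r (emb p))) ` ?E \<union> K0 \<union> K1"
      "constraints (insert p C) ?W' =
        {(axis p 1, r (emb p))} \<union> K0 \<union> (\<lambda>((v, d), f). (v + f, d)) ` (K1 \<times> ?E)"
      "\<And>v d. (v, d) \<in> K0 \<Longrightarrow> ?w \<bullet> v = 0" "\<And>v d. (v, d) \<in> K1 \<Longrightarrow> ?w \<bullet> v = 1"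
      "finite ?E" "?E \<noteq> {}" "?E \<subseteq> lattice_points" "\<And>f. f \<in> ?E \<Longrightarrow> ?w \<bullet> f = 0"
      using constraints_step[OF step.hyps refl] by blast
    have img: "region (constraints (insert p C) ?W') = trop_map ?w (convex hull ?E) ` region (constraints C W)"
      unfolding K(1,2) by (rule trop_map_region[symmetric]) (use K in \<open>auto simp: inner_axis_axis\<close>)
    have b: "bounded (region (constraints (insert p C) ?W'))" "region (constraints (insert p C) ?W') \<noteq> {}"
      unfolding img using step.IH bounded_trop_map_image[OF K(5,6)] by auto
    have r: "rational_polytope (region (constraints (insert p C) ?W'))"
      by (rule rat[OF stage.step[OF step.hyps] b])
    have "convex hull ?E \<subseteq> {v. ?w \<bullet> v = 0}"
      by (rule hull_minimal) (use K(8) in \<open>auto intro: convex_hyperplane\<close>)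
    then have "mutation_datum ?w (convex hull ?E)"
      unfolding mutation_datum_def lattice_polytope_def
      using primitive_minus_axis K(5-7) by blast
    then have "mutation_M (region (constraints C W)) (region (constraints (insert p C) ?W'))"
      unfolding mutation_M_def using step.IH r img by blast
    then show ?case using step.IH b r by (auto intro: rtranclp.rtrancl_into_rtrancl)
  qed
qed

text \<open>The same splitting by heights with the constants forgotten is the situation of
  \<open>mutation_N_convex_hull\<close> with \<open>g = axis p 1\<close>.\<close>

lemma stage_mutation_N:
  assumes "stage C W"
  shows "mutation_N\<^sup>*\<^sup>* (convex hull (fst ` init_constraints))
    (convex hull (fst ` constraints C W))"
  using assms
proof induction
  case init
  then show ?case by simp
next
  case (step C W p)
  let ?W' = "{(v, q, d) \<in> W. q \<noteq> emb p} \<union>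
    (\<lambda>((v, q', d), q). (v - axis p 1, q, d)) ` ({(v, q, d) \<in> W. q = emb p} \<times> {q. cov q (emb p)})"
  let ?w = "- axis p (1::real)" and ?E = "(\<lambda>q. - e q) ` {q. cov q (emb p)}"
  obtain K0 K1 where K:
    "constraints C W = (\<lambda>f. (axis p 1 + f, r (emb p))) ` ?E \<union> K0 \<union> K1"
    "constraints (insert p C) ?W' =
      {(axis p 1, r (emb p))} \<union> K0 \<union> (\<lambda>((v, d), f). (v + f, d)) ` (K1 \<times> ?E)"
    "\<And>v d. (v, d) \<in> K0 \<Longrightarrow> ?w \<bullet> v = 0" "\<And>v d. (v, d) \<in> K1 \<Longrightarrow> ?w \<bullet> v = 1"
    "finite ?E" "?E \<noteq> {}" "?E \<subseteq> lattice_points" "\<And>f. f \<in> ?E \<Longrightarrow> ?w \<bullet> f = 0"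
    using constraints_step[OF step.hyps refl] by blast
  have fin: "finite (K0 \<union> K1)" "K0 \<union> K1 \<subseteq> lattice_points \<times> \<int>"
    using constraints_finite[OF step.hyps(1)] constraints_integral[OF step.hyps(1)] K(1) by auto
  have "fst ` constraints C W = (+) (axis p 1) ` ?E \<union> fst ` K0 \<union> fst ` K1"
    unfolding K(1) by (simp add: image_Un image_image)
  moreover have "fst ` constraints (insert p C) ?W' = {axis p 1} \<union> fst ` K0 \<union> (fst ` K1 + ?E)"
    unfolding K(2) by (force simp: image_Un set_plus_def)
  moreover have "mutation_N (convex hull ((+) (axis p 1) ` ?E \<union> fst ` K0 \<union> fst ` K1))
    (convex hull ({axis p 1} \<union> fst ` K0 \<union> (fst ` K1 + ?E)))"
    by (rule mutation_N_convex_hull[where w = ?w])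
      (use primitive_minus_axis K(3-8) fin axis_lattice in \<open>auto simp: inner_axis_axis\<close>)
  ultimately show ?case using step.IH by (simp add: rtranclp.rtrancl_into_rtrancl)
qed

text \<open>An untransferred element of maximal rank has all its unmarked upper covers transferred,
  so it can come next.\<close>

lemma ex_stage_UNIV: "\<exists>W. stage UNIV W"
proof -
  have "m \<le> CARD('p) \<Longrightarrow> \<exists>C W. stage C W \<and> card C = m" for m
  proof (induction m)
    case 0
    show ?case using stage.init by force
  next
    case (Suc m)
    then obtain C W where C: "stage C W" "card C = m" by auto
    have "C \<noteq> UNIV" using C(2) Suc.prems by auto
    then have "- C \<noteq> {}" by blast
    then have "Max ((rank \<circ> emb) ` (- C)) \<in> (rank \<circ> emb) ` (- C)" by (intro Max_in) auto
    then obtain p where p: "p \<notin> C" "rank (emb p) = Max ((rank \<circ> emb) ` (- C))" by auto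
    have "p' \<in> C" if "cov (emb p) (emb p')" for p'
    proof (rule ccontr)
      assume "p' \<notin> C"
      then have "rank (emb p') \<le> Max ((rank \<circ> emb) ` (- C))" by (intro Max_ge) auto
      with rank_less[OF that] p(2) show False by simp
    qed
    from stage.step[OF C(1) p(1) this] show ?case
      by (intro exI conjI) (assumption, simp add: C(2) p(1))
  qed
  then obtain C W where "stage C W" "card C = CARD('p)" by blast
  then show ?thesis by (metis card_eq_UNIV_imp_eq_UNIV finite)
qed

section \<open>The first and the last region as order and chain polytope\<close>

definition origin :: "real ^ 'p" where "origin = (\<chi> i. c (emb i))"

text \<open>The image of \<open>origin\<close> under the transfer before centring:
  \<open>c p\<close> minus the common value of \<open>c\<close> on the lower covers of
  \<open>p\<close>.\<close>

definition slack :: "real ^ 'p" where "slack = (\<chi> i. r (emb i))"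

lemma init_region_iff: "x \<in> region init_constraints \<longleftrightarrow> (\<forall>q p. cov q p \<longrightarrow> ext x q \<le> ext x p)"
proof
  assume x: "x \<in> region init_constraints"
  show "\<forall>q p. cov q p \<longrightarrow> ext x q \<le> ext x p"
  proof (intro allI impI)
    fix q p assume qp: "cov q p"
    then consider i where "p = emb i" | "p \<in> A" using cov_field by blast
    then show "ext x q \<le> ext x p"
    proof cases
      case 1
      have "(axis i 1 - e q, r (emb i)) \<in> init_constraints"
        using qp 1 by (auto simp: constraints_def)
      from regionD[OF x this] show ?thesis
        using qp 1 by (simp add: ext_def r_eq inner_diff_right)
    next
      case 2
      have "(0 - e q, r p) \<in> init_constraints"
        using qp 2 by (force simp: constraints_def image_iff)
      from regionD[OF x this] show ?thesis
        using qp 2 by (simp add: ext_def r_eq inner_diff_right e_marked)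
    qed
  qed
next
  assume "\<forall>q p. cov q p \<longrightarrow> ext x q \<le> ext x p"
  then show "x \<in> region init_constraints"
    by (fastforce simp: region_def constraints_def ext_def r_eq inner_diff_right e_marked)
qed

lemma init_region_mono:
  assumes "x \<in> region init_constraints"
  shows "cov\<^sup>+\<^sup>+ q p \<Longrightarrow> ext x q \<le> ext x p"
  by (rule ext_mono) (use assms in \<open>auto simp: init_region_iff\<close>)

text \<open>Covering relations generate the order, and two marked elements never cover each other,
  so every cover occurs among the inequalities of the order polytope.\<close>

lemma order_polytope_eq: "order_polytope = (+) origin ` region init_constraints"
proof -
  have ext_emb: "ext x (emb p) = (origin + x) $ p" for x p
    by (simp add: ext_def inner_axis origin_def)
  have iff: "origin + x \<in> order_polytope \<longleftrightarrow> x \<in> region init_constraints" for x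
  proof
    assume x: "origin + x \<in> order_polytope"
    have "ext x q \<le> ext x p" if "cov q p" for q p
    proof -
      have t: "cov\<^sup>+\<^sup>+ q p" using that by blast
      have "q \<in> range emb \<or> q \<in> A" "p \<in> range emb \<or> p \<in> A" "\<not> (q \<in> A \<and> p \<in> A)"
        using cov_field[OF that] cov_marked[OF that] by auto
      then show ?thesis
        using x t unfolding order_polytope_def by (auto simp: ext_emb ext_marked)
    qed
    then show "x \<in> region init_constraints" by (simp add: init_region_iff)
  next
    assume "x \<in> region init_constraints"
    from init_region_mono[OF this] show "origin + x \<in> order_polytope"
      unfolding order_polytope_def
      by (intro CollectI conjI allI ballI impI) (metis ext_emb ext_marked)+
  qed
  show ?thesis
  proof (intro equalityI subsetI)
    fix u assume "u \<in> order_polytope"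
    then show "u \<in> (+) origin ` region init_constraints"
      using iff[of "u - origin"] by (intro image_eqI[of _ _ "u - origin"]) auto
  qed (use iff in auto)
qed

text \<open>Keeps what the chain inequalities need of the composite map: \<open>y\<close> comes from
  an order pattern \<open>x\<close> whose drop from \<open>p\<close> to any lower cover bounds the
  transferred coordinate at \<open>p\<close>.\<close>

lemma stage_transfer:
  assumes "stage C W" "y \<in> region (constraints C W)"
  shows "\<exists>x\<in>region init_constraints. (\<forall>p\<in>C. \<forall>q. cov q (emb p) \<longrightarrow> y $ p \<le> x $ p - x \<bullet> e q) \<and>
    (\<forall>p. p \<notin> C \<longrightarrow> y $ p = x $ p)"
  using assms
proof (induction arbitrary: y)
  case init
  then show ?case by auto
next
  case (step C W p)
  let ?W' = "{(v, q, d) \<in> W. q \<noteq> emb p} \<union>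
    (\<lambda>((v, q', d), q). (v - axis p 1, q, d)) ` ({(v, q, d) \<in> W. q = emb p} \<times> {q. cov q (emb p)})"
  let ?w = "- axis p (1::real)" and ?E = "(\<lambda>q. - e q) ` {q. cov q (emb p)}"
  obtain K0 K1 where K:
    "constraints C W = (\<lambda>f. (axis p 1 + f, r (emb p))) ` ?E \<union> K0 \<union> K1"
    "constraints (insert p C) ?W' =
      {(axis p 1, r (emb p))} \<union> K0 \<union> (\<lambda>((v, d), f). (v + f, d)) ` (K1 \<times> ?E)"
    "\<And>v d. (v, d) \<in> K0 \<Longrightarrow> ?w \<bullet> v = 0" "\<And>v d. (v, d) \<in> K1 \<Longrightarrow> ?w \<bullet> v = 1"
    "finite ?E" "?E \<noteq> {}" "?E \<subseteq> lattice_points" "\<And>f. f \<in> ?E \<Longrightarrow> ?w \<bullet> f = 0"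
    using constraints_step[OF step.hyps refl] by blast
  have img: "region (constraints (insert p C) ?W') = trop_map ?w (convex hull ?E) ` region (constraints C W)"
    unfolding K(1,2) by (rule trop_map_region[symmetric]) (use K in \<open>auto simp: inner_axis_axis\<close>)
  obtain z where z: "z \<in> region (constraints C W)" "y = trop_map ?w (convex hull ?E) z"
    using step.prems img by blast
  obtain x where x: "x \<in> region init_constraints"
    "\<forall>p\<in>C. \<forall>q. cov q (emb p) \<longrightarrow> z $ p \<le> x $ p - x \<bullet> e q" "\<forall>p. p \<notin> C \<longrightarrow> z $ p = x $ p"
    using step.IH[OF z(1)] by blast
  obtain f where f: "f \<in> ?E" "(INF v\<in>convex hull ?E. z \<bullet> v) = z \<bullet> f"
    "\<And>f'. f' \<in> ?E \<Longrightarrow> z \<bullet> f \<le> z \<bullet> f'"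
    using INF_inner_convex_hull[OF K(5,6)] by blast
  have y: "y = z + (z \<bullet> f) *\<^sub>R axis p 1" using z(2) unfolding trop_map_def f(2) by simp
  have other: "y $ i = z $ i" if "i \<noteq> p" for i using that by (simp add: y axis_def)
  have "y $ p \<le> x $ p - x \<bullet> e q" if q: "cov q (emb p)" for q
  proof -
    \<comment> \<open>A lower cover of \<open>p\<close> is marked or not yet transferred, and there
      \<open>z\<close> still agrees with \<open>x\<close>.\<close>
    have "z \<bullet> e q = x \<bullet> e q"
    proof (cases "q \<in> A")
      case False
      then obtain i where i: "q = emb i" using cov_field[OF q] by blast
      then have "i \<notin> C" using stage_upward_closed[OF step.hyps(1)] step.hyps(2) q by blast
      then show ?thesis using x(3) i by (simp add: inner_axis)
    qed (simp add: e_marked)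
    then have "z \<bullet> f \<le> - (x \<bullet> e q)" using f(3)[of "- e q"] q by auto
    then show ?thesis using x(3) step.hyps(2) by (simp add: y)
  qed
  moreover have "p' \<noteq> p" if "p' \<in> C" for p' using that step.hyps(2) by blast
  ultimately show ?case using x other by (intro bexI[OF _ x(1)]) auto
qed

text \<open>The bounds telescope along the chain, which need not be saturated.\<close>

lemma chain_sum_le:
  assumes le: "\<And>q p. cov q (emb p) \<Longrightarrow> u $ p \<le> ext x (emb p) - ext x q"
    and mono: "\<And>q p. cov\<^sup>+\<^sup>+ q p \<Longrightarrow> ext x q \<le> ext x p"
  shows "sorted_wrt (cov\<^sup>+\<^sup>+) (a # map emb ps @ [b]) \<Longrightarrow> (\<Sum>p\<leftarrow>ps. u $ p) \<le> ext x b - ext x a"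
proof (induction ps arbitrary: a)
  case Nil
  then show ?case using mono by simp
next
  case (Cons p ps)
  have "cov\<^sup>+\<^sup>+ a (emb p)" using Cons.prems by simp
  \<comment> \<open>The last step of a path from \<open>a\<close> to \<open>p\<close> starts at a
    lower cover of \<open>p\<close> that is at or above \<open>a\<close>.\<close>
  then have "\<exists>q. cov\<^sup>*\<^sup>* a q \<and> cov q (emb p)"
    by (cases rule: tranclp.cases) (auto intro: tranclp_into_rtranclp)
  then obtain q where "cov\<^sup>*\<^sup>* a q" "cov q (emb p)" by blast
  then have "ext x a \<le> ext x q" using mono by (metis order_refl rtranclpD)
  then have "u $ p \<le> ext x (emb p) - ext x a" using le[OF \<open>cov q (emb p)\<close>] by simp
  moreover have "(\<Sum>p\<leftarrow>ps. u $ p) \<le> ext x b - ext x (emb p)" using Cons by simp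
  ultimately show ?case by simp
qed

text \<open>Triples of the last stage are chain inequalities shifted by \<open>slack\<close>, which
  gives one inclusion. For the other, arbitrary chains are handled by telescoping the drops of an
  order pattern from which \<open>y\<close> comes.\<close>

lemma chain_polytope_eq:
  assumes "stage UNIV W"
  shows "chain_polytope = (+) slack ` region (constraints UNIV W)"
proof -
  have iff: "slack + y \<in> chain_polytope \<longleftrightarrow> y \<in> region (constraints UNIV W)" for y
  proof
    assume y: "slack + y \<in> chain_polytope"
    have "- d \<le> y \<bullet> (v - e q)" if "(v, q, d) \<in> W" for v q d
    proof -
      note tr = stage_chain_triple[OF assms that]
      \<comment> \<open>Every coordinate has been transferred, so \<open>q\<close> is marked; then
        \<open>ps\<close> is nonempty, as an empty chain ends at an unmarked
        \<open>q\<close>.\<close>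
      obtain ps b where ps: "q \<in> A" "b \<in> A" "v = - (\<Sum>p\<leftarrow>ps. axis p 1)"
        "sorted_wrt (cov\<^sup>+\<^sup>+) (q # map emb ps @ [b])" "ps \<noteq> []"
        "d + (\<Sum>p\<leftarrow>ps. r (emb p)) + c q = c b"
        using tr unfolding chain_triple_def by blast
      then have "(\<Sum>p\<leftarrow>ps. (slack + y) $ p) \<le> c b - c q"
        using y unfolding chain_polytope_def by blast
      then show ?thesis
        using ps(6) by (simp add: ps(3) e_marked[OF ps(1)] inner_sum_list_axis slack_def sum_list_addf)
    qed
    moreover have "- r (emb p) \<le> y $ p" for p
    proof -
      have "0 \<le> (slack + y) $ p" using y unfolding chain_polytope_def by blast
      then show ?thesis by (simp add: slack_def)
    qed
    ultimately show "y \<in> region (constraints UNIV W)"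
      by (auto simp: region_def constraints_def inner_axis)
  next
    assume y: "y \<in> region (constraints UNIV W)"
    then obtain x where x: "x \<in> region init_constraints"
      "\<And>p q. cov q (emb p) \<Longrightarrow> y $ p \<le> x $ p - x \<bullet> e q"
      using stage_transfer[OF assms y] by blast
    have "(slack + y) $ p \<le> ext x (emb p) - ext x q" if "cov q (emb p)" for p q
      using x(2)[OF that] r_eq[OF that] by (simp add: slack_def ext_def inner_axis)
    from chain_sum_le[OF this init_region_mono[OF x(1)]]
    have "sorted_wrt (cov\<^sup>+\<^sup>+) (a # map emb ps @ [b]) \<Longrightarrow> (\<Sum>p\<leftarrow>ps. (slack + y) $ p) \<le> ext x b - ext x a"
      for a b ps .
    moreover have "0 \<le> (slack + y) $ p" for p
    proof -
      have "(axis p 1, r (emb p)) \<in> constraints UNIV W" by (auto simp: constraints_def)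
      from regionD[OF y this] show ?thesis by (simp add: slack_def inner_axis)
    qed
    ultimately show "slack + y \<in> chain_polytope"
      unfolding chain_polytope_def by (intro CollectI conjI allI ballI impI) (metis ext_marked)+
  qed
  show ?thesis
  proof (intro equalityI subsetI)
    fix u assume "u \<in> chain_polytope"
    then show "u \<in> (+) slack ` region (constraints UNIV W)"
      using iff[of "u - slack"] by (intro image_eqI[of _ _ "u - slack"]) auto
  qed (use iff in auto)
qed

lemma origin_lattice: "origin \<in> lattice_points" and slack_lattice: "slack \<in> lattice_points"
  using c_int r_int by (auto simp: origin_def slack_def lattice_points_def)

section \<open>Boundedness\<close>

lemma ex_marked_below: "\<exists>a\<in>A. cov\<^sup>+\<^sup>+ a (emb i)"
proof (induction "rank (emb i)" arbitrary: i rule: less_induct)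
  case less
  obtain q where q: "cov q (emb i)" using ex_lower by blast
  show ?case
  proof (cases "q \<in> A")
    case False
    then obtain j where j: "q = emb j" using cov_field[OF q] by blast
    then obtain a where "a \<in> A" "cov\<^sup>+\<^sup>+ a (emb j)" using less rank_less[OF q] by blast
    then show ?thesis using q j by (blast intro: tranclp.trancl_into_trancl)
  qed (use q in blast)
qed

text \<open>Climbing raises the rank, so the induction is on the number of unmarked elements of
  higher rank.\<close>

lemma ex_marked_above: "\<exists>a\<in>A. cov\<^sup>+\<^sup>+ (emb i) a"
proof (induction "card {j. rank (emb i) < rank (emb j)}" arbitrary: i rule: less_induct)
  case less
  obtain q where q: "cov (emb i) q" using ex_upper by blast
  show ?case
  proof (cases "q \<in> A")
    case False
    then obtain j where j: "q = emb j" using cov_field[OF q] by blast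
    have "card {k. rank (emb j) < rank (emb k)} < card {k. rank (emb i) < rank (emb k)}"
      using rank_less[OF q] j by (intro psubset_card_mono) auto
    then obtain a where "a \<in> A" "cov\<^sup>+\<^sup>+ (emb j) a" using less by blast
    then show ?thesis using q j by (blast intro: tranclp_into_tranclp2)
  qed (use q in blast)
qed

lemma bounded_order_polytope: "bounded order_polytope"
proof -
  obtain a b where ab: "\<And>i. a i \<in> A \<and> cov\<^sup>+\<^sup>+ (a i) (emb i)" "\<And>i. b i \<in> A \<and> cov\<^sup>+\<^sup>+ (emb i) (b i)"
    using ex_marked_below ex_marked_above by metis
  have "order_polytope \<subseteq> cbox (\<chi> i. c (a i)) (\<chi> i. c (b i))"
    using ab by (auto simp: order_polytope_def mem_box_cart)
  then show ?thesis using bounded_cbox bounded_subset by blast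
qed

lemma bounded_init_region: "bounded (region init_constraints)"
  using bounded_translation[OF bounded_order_polytope, of "- origin"]
  by (simp add: order_polytope_eq image_image)

section \<open>Mutation equivalence for marked posets\<close>

theorem order_chain_mutation_equiv_M:
  assumes "order_polytope \<noteq> {}"
  shows "mutation_equiv_M ((+) (- origin) ` order_polytope) ((+) (- slack) ` chain_polytope)"
proof -
  obtain W where W: "stage UNIV W" using ex_stage_UNIV by blast
  have ne: "region init_constraints \<noteq> {}" using assms by (auto simp: order_polytope_eq)
  have "(+) (- origin) ` order_polytope = region init_constraints"
    "(+) (- slack) ` chain_polytope = region (constraints UNIV W)"
    unfolding order_polytope_eq chain_polytope_eq[OF W] by (simp_all add: image_image)
  then show ?thesis
    unfolding mutation_equiv_M_def
    using stage_region[OF W bounded_init_region ne] stage_region[OF stage.init bounded_init_region ne]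
    by simp
qed

theorem order_chain_mutation_equiv_N:
  assumes unit: "\<And>q p. cov q p \<Longrightarrow> c p - c q = 1"
  shows "mutation_equiv_N (dual order_polytope) (dual chain_polytope)"
proof -
  obtain W where W: "stage UNIV W" using ex_stage_UNIV by blast
  \<comment> \<open>Each constant is a difference of \<open>c\<close> along one cover, hence
    \<open>1\<close>, so every region is the polar of its normals.\<close>
  have one: "constraints C W = fst ` constraints C W \<times> {1}" if "stage C W" for C W
  proof -
    have "r (emb p) = 1" for p using ex_lower[of p] r_eq unit by metis
    moreover have "d = 1" if "(v, q, d) \<in> W" for v q d
      using stage_chain_triple[OF \<open>stage C W\<close> that] unit by (auto simp: chain_triple_def)
    ultimately have "snd k = 1" if "k \<in> constraints C W" for k
      using that by (auto simp: constraints_def)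
    then show ?thesis by (force simp: image_iff)
  qed
  have fin: "finite (fst ` constraints C W)" "fst ` constraints C W \<subseteq> lattice_points"
    if "stage C W" for C W
    using constraints_finite[OF that] constraints_integral[OF that] by auto
  have ne: "fst ` constraints C W \<noteq> {}" for C W
    using ex_lower by (cases "C = {}") (auto simp: constraints_def)
  have "region init_constraints \<noteq> {}"
  proof -
    have "0 \<in> region init_constraints"
      by (subst one[OF stage.init]) (auto simp: region_def)
    then show ?thesis by blast
  qed
  then have b: "bounded (region (constraints UNIV W))"
    using stage_region[OF W bounded_init_region] by blast
  have dual: "dual ((+) a ` region (constraints C W)) = convex hull (fst ` constraints C W)"
    if "stage C W" "bounded (region (constraints C W))" "a \<in> lattice_points" for a C W
    using dual_translated_region[OF fin(1)[OF that(1)] ne fin(2)[OF that(1)] _ that(3)] that(2)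
      one[OF that(1)] by metis
  have lat: "lattice_polytope (convex hull (fst ` constraints C W))" if "stage C W" for C W
    unfolding lattice_polytope_def using fin[OF that] ne by (intro exI conjI) (assumption | rule refl)+
  show ?thesis
    unfolding mutation_equiv_N_def order_polytope_eq chain_polytope_eq[OF W]
      dual[OF stage.init bounded_init_region origin_lattice] dual[OF W b slack_lattice]
    using lat[OF W] lat[OF stage.init] stage_mutation_N[OF W] by blast
qed

end

section \<open>Type C\<close>

text \<open>
  For \<open>2\<rho>\<close> this is the interior lattice point of the Gelfand-Tsetlin polytope. The index is
  written so that it never exceeds \<open>n\<close>; for nodes of the poset it equals \<open>n + 2 - k - l\<close>.
\<close>

definition center :: "nat \<Rightarrow> weight \<Rightarrow> node \<Rightarrow> real" where
  "center n x p =
     (case p of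
        BNode l k \<Rightarrow> weight_partial_sum n x (n - (k + l - 2))
      | ANode l k \<Rightarrow> weight_partial_sum n x (n - (k + l - 2)) - 1)"

text \<open>The height in the poset; on its nodes it equals \<open>center\<close> for
  \<open>2 * rho\<close>.\<close>

definition node_rank :: "nat \<Rightarrow> node \<Rightarrow> nat" where
  "node_rank n p = (case p of BNode l k \<Rightarrow> 2 * (n + 2 - k - l) | ANode l k \<Rightarrow> 2 * (n + 2 - k - l) - 1)"

lemma center_marked:
  assumes "a \<in> marked n"
  shows "center n x a = mark n x a"
proof -
  consider k where "a = BNode 1 k" "1 \<le> k" "k \<le> n" | l where "a = BNode l (n + 2 - l)" "1 \<le> l" "l \<le> n"
    using assms by (auto simp: marked_def)
  then show ?thesis
  proof cases
    case 1
    then have "n - (k + 1 - 2) = n + 1 - k" by linarith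
    then show ?thesis using 1 by (simp add: center_def mark_def)
  next
    case 2
    \<comment> \<open>The partial sum is empty. For \<open>l = 1\<close> the node is the last one of
      the top row, which the test \<open>k \<le> n\<close> in \<open>mark\<close> sends to
      \<open>0\<close>.\<close>
    then have "n - (n + 2 - l + l - 2) = 0" "\<not> (l = 1 \<and> n + 2 - l \<le> n)" by auto
    then show ?thesis using 2 by (simp add: center_def mark_def weight_partial_sum_def)
  qed
qed

lemma generating_rel_poset: "generating_rel n q p \<Longrightarrow> q \<in> poset n \<and> p \<in> poset n"
  by (induction rule: generating_rel.induct) (auto simp: poset_def)

lemma generating_rel_rank: "generating_rel n q p \<Longrightarrow> node_rank n q < node_rank n p"
  by (induction rule: generating_rel.induct) (auto simp: node_rank_def)

lemma range_Rep_coord: "range (Rep_coord :: 'n::finite coord \<Rightarrow> node) = poset CARD('n) - marked CARD('n)"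
  using type_definition.Rep_range[OF type_definition_coord] .

lemma unmarked_cases:
  assumes "p \<in> poset n - marked n"
  obtains l k where "p = ANode l k" "1 \<le> l" "l \<le> n" "1 \<le> k" "k \<le> n + 1 - l"
  | l k where "p = BNode l k" "2 \<le> l" "l \<le> n" "1 \<le> k" "k \<le> n + 1 - l"
proof -
  consider l k where "p = ANode l k" "1 \<le> l" "l \<le> n" "1 \<le> k" "k \<le> n + 1 - l"
    | l k where "p = BNode l k" "1 \<le> l" "l \<le> n" "1 \<le> k" "k \<le> n + 2 - l"
    using assms by (auto simp: poset_def)
  then show thesis
  proof cases
    case 2
    \<comment> \<open>For \<open>l = 1\<close> this leaves \<open>k \<le> n\<close>, where the node
      carries a top mark; hence \<open>l \<ge> 2\<close>.\<close>
    have "k \<noteq> n + 2 - l" using 2 assms by (auto simp: marked_def)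
    moreover from this have "l \<noteq> 1" using 2 assms by (auto simp: marked_def)
    ultimately show ?thesis using 2 that(2)[of l k] by force
  qed (use that(1) in blast)
qed

lemma weight_partial_sum_int:
  assumes "\<And>i. i \<in> {1..n} \<Longrightarrow> coroot_pairing n x i \<in> \<int>" "j \<le> n"
  shows "weight_partial_sum n x j \<in> \<int>"
  unfolding weight_partial_sum_def using assms by (intro Ints_sum) auto

text \<open>All lower covers of a node have the same letter and the same index sum
  \<open>k + l\<close>, and \<open>center\<close> depends only on these. This is what
  \<open>balanced\<close> asks for.\<close>

lemma center_lower:
  assumes "generating_rel n q p"
  shows "center n x q = (case p of ANode l k \<Rightarrow> weight_partial_sum n x (n - (k + l - 1))
    | BNode l k \<Rightarrow> weight_partial_sum n x (n - (k + l - 2)) - 1)"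
  using assms by (induction rule: generating_rel.induct) (auto simp: center_def Suc_diff_le)

lemma type_C_marked_poset:
  assumes int: "\<And>i. i \<in> {1..CARD('n)} \<Longrightarrow> coroot_pairing CARD('n) x i \<in> \<int>"
  shows "marked_poset (generating_rel CARD('n)) (Rep_coord :: 'n::finite coord \<Rightarrow> node)
    (marked CARD('n)) (center CARD('n) x) (node_rank CARD('n))"
proof
  let ?n = "CARD('n)"
  show "inj (Rep_coord :: 'n coord \<Rightarrow> node)" by (meson Rep_coord_inject injI)
  have "marked ?n = BNode 1 ` {1..?n} \<union> (\<lambda>l. BNode l (?n + 2 - l)) ` {1..?n}"
    by (auto simp: marked_def)
  then show "finite (marked ?n)" by simp
  show "marked ?n \<inter> range (Rep_coord :: 'n coord \<Rightarrow> node) = {}"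
    by (auto simp: range_Rep_coord)
  show "q \<in> marked ?n \<union> range (Rep_coord :: 'n coord \<Rightarrow> node) \<and>
      p \<in> marked ?n \<union> range (Rep_coord :: 'n coord \<Rightarrow> node)"
    if "generating_rel ?n q p" for q p
    using generating_rel_poset[OF that] by (auto simp: range_Rep_coord)
  show "q \<notin> marked ?n" if "generating_rel ?n q p" "p \<in> marked ?n" for q p
    using that by (cases rule: generating_rel.cases) (auto simp: marked_def)
  show "node_rank ?n q < node_rank ?n p" if "generating_rel ?n q p" for q p
    by (rule generating_rel_rank[OF that])
  show "\<exists>q. generating_rel ?n q (Rep_coord i)" for i :: "'n coord"
    using Rep_coord[of i]
    by (cases rule: unmarked_cases) (force intro: generating_rel.intros)+
  show "\<exists>q. generating_rel ?n (Rep_coord i) q" for i :: "'n coord"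
    using Rep_coord[of i]
    by (cases rule: unmarked_cases) (force intro: generating_rel.intros)+
  show "center ?n x q = center ?n x q'" if "generating_rel ?n q p" "generating_rel ?n q' p" for q q' p
    using center_lower[OF that(1)] center_lower[OF that(2)] by simp
  show "center ?n x p \<in> \<int>" for p
    using weight_partial_sum_int[OF int] by (auto simp: center_def split: node.splits)
qed

lemma GT_eq_order_polytope:
  fixes x :: weight
  assumes "marked_poset (generating_rel CARD('n)) (Rep_coord :: 'n::finite coord \<Rightarrow> node)
    (marked CARD('n)) (center CARD('n) x) (node_rank CARD('n))"
  shows "GT x = marked_poset.order_polytope (generating_rel CARD('n)) (Rep_coord :: 'n coord \<Rightarrow> node)
    (marked CARD('n)) (center CARD('n) x)"
  unfolding GT_def Let_def marked_poset.order_polytope_def[OF assms] prec_def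
  by (simp add: center_marked)

lemma FFLV_eq_chain_polytope:
  fixes x :: weight
  assumes "marked_poset (generating_rel CARD('n)) (Rep_coord :: 'n::finite coord \<Rightarrow> node)
    (marked CARD('n)) (center CARD('n) x) (node_rank CARD('n))"
  shows "FFLV x = marked_poset.chain_polytope (generating_rel CARD('n)) (Rep_coord :: 'n coord \<Rightarrow> node)
    (marked CARD('n)) (center CARD('n) x)"
  unfolding FFLV_def Let_def marked_poset.chain_polytope_def[OF assms] prec_def
  by (simp add: center_marked)

lemma GT_nonempty:
  assumes x: "x \<in> dominant_weights CARD('n)"
  shows "(GT x :: (real ^ ('n::finite) coord) set) \<noteq> {}"
proof -
  let ?n = "CARD('n)"
  \<comment> \<open>The center itself can leave the polytope: its shift by \<open>1\<close> breaks
    monotonicity when a coroot pairs to \<open>0\<close>. Without the shift, dominance makes the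
    values monotone.\<close>
  define f where "f p = weight_partial_sum ?n x (case p of BNode l k \<Rightarrow> ?n - (k + l - 2)
    | ANode l k \<Rightarrow> ?n - (k + l - 2))" for p
  have mono: "weight_partial_sum ?n x i \<le> weight_partial_sum ?n x j" if "i \<le> j" "j \<le> ?n" for i j
    unfolding weight_partial_sum_def using that x
    by (intro sum_mono2) (auto simp: dominant_weights_def)
  have gen: "generating_rel ?n q p \<Longrightarrow> f q \<le> f p" for q p
    by (induction rule: generating_rel.induct) (auto simp: f_def intro!: mono)
  have "prec ?n q p \<Longrightarrow> f q \<le> f p" for q p
    unfolding prec_def by (induction rule: tranclp_induct) (use gen in \<open>auto intro: order_trans\<close>)
  moreover have "f a = mark ?n x a" if "a \<in> marked ?n" for a
    using that center_marked[OF that, of x] by (auto simp: f_def center_def marked_def)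
  ultimately have "(\<chi> i. f (Rep_coord i)) \<in> (GT x :: (real ^ 'n coord) set)"
    unfolding GT_def Let_def by (auto simp: simp flip: \<open>\<And>a. a \<in> marked ?n \<Longrightarrow> f a = mark ?n x a\<close>)
  then show ?thesis by blast
qed

section \<open>The weight \<open>2 * rho\<close>\<close>

lemma sum_positive_roots:
  assumes m: "1 \<le> m" "m \<le> n"
  shows "(\<Sum>\<alpha>\<in>positive_roots n. \<alpha> m) = 2 * real m"
proof -
  let ?P = "SIGMA j:{1..n}. {1..<j}"
  let ?L = "(\<lambda>i m. 2 * eps i m) ` {1..n}"
  let ?D = "(\<lambda>(j, i) m. eps j m - eps i m) ` ?P"
  let ?S = "(\<lambda>(j, i) m. eps j m + eps i m) ` ?P"
  have roots: "positive_roots n = ?L \<union> ?D \<union> ?S"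
    unfolding positive_roots_def by (intro arg_cong2[of _ _ _ _ "(\<union>)"]) (force simp: image_iff)+
  \<comment> \<open>The roots form a set, so the three families must be separated before summing:
    differences have a negative coordinate, long roots have a coordinate \<open>2\<close> and no
    negative one, sums have all coordinates between \<open>0\<close> and \<open>1\<close>.\<close>
  have D_neg: "\<exists>m. \<alpha> m < 0" if \<alpha>: "\<alpha> \<in> ?D" for \<alpha>
  proof -
    obtain j i where "\<alpha> = (\<lambda>m. eps j m - eps i m)" "i < j" using \<alpha> by auto
    then have "\<alpha> i < 0" by (simp add: eps_def)
    then show ?thesis ..
  qed
  have S_le: "\<alpha> m \<le> 1" "0 \<le> \<alpha> m" if "\<alpha> \<in> ?S" for \<alpha> m using that by (auto simp: eps_def)
  have L_2: "\<exists>m. \<alpha> m = 2" if "\<alpha> \<in> ?L" for \<alpha> using that by (auto simp: eps_def)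
  have L_nonneg: "0 \<le> \<alpha> m" if "\<alpha> \<in> ?L" for \<alpha> m using that by (auto simp: eps_def)
  have disj1: "?L \<inter> ?D = {}"
  proof (rule ccontr)
    assume "?L \<inter> ?D \<noteq> {}"
    then obtain \<alpha> where "\<alpha> \<in> ?L" "\<alpha> \<in> ?D" by blast
    then show False using D_neg L_nonneg by (meson not_less)
  qed
  have disj2: "(?L \<union> ?D) \<inter> ?S = {}"
  proof (rule ccontr)
    assume "(?L \<union> ?D) \<inter> ?S \<noteq> {}"
    then obtain \<alpha> where a: "\<alpha> \<in> ?L \<or> \<alpha> \<in> ?D" "\<alpha> \<in> ?S" by blast
    from a(1) show False
    proof
      assume "\<alpha> \<in> ?L"
      then obtain m where "\<alpha> m = 2" using L_2 by blast
      then show False using S_le(1)[OF a(2), of m] by simp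
    next
      assume "\<alpha> \<in> ?D"
      then obtain m where "\<alpha> m < 0" using D_neg by blast
      then show False using S_le(2)[OF a(2), of m] by simp
    qed
  qed
  have injL: "inj_on (\<lambda>i m. 2 * eps i m) {1..n}"
    by (rule inj_onI) (drule fun_cong, auto simp: eps_def split: if_splits)
  have injD: "inj_on (\<lambda>(j, i) m. eps j m - eps i m) ?P"
  proof (rule inj_onI, clarify)
    fix j i j' i' assume "i \<in> {1..<j}" "i' \<in> {1..<j'}"
      and eq: "(\<lambda>m. eps j m - eps i m) = (\<lambda>m. eps j' m - eps i' m)"
    then show "j = j' \<and> i = i'"
      using fun_cong[OF eq, of j] fun_cong[OF eq, of i] by (auto simp: eps_def split: if_splits)
  qed
  have injS: "inj_on (\<lambda>(j, i) m. eps j m + eps i m) ?P"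
  proof (rule inj_onI, clarify)
    fix j i j' i' assume "i \<in> {1..<j}" "i' \<in> {1..<j'}"
      and eq: "(\<lambda>m. eps j m + eps i m) = (\<lambda>m. eps j' m + eps i' m)"
    then show "j = j' \<and> i = i'"
      using fun_cong[OF eq, of j] fun_cong[OF eq, of i] by (auto simp: eps_def split: if_splits)
  qed
  have "(\<Sum>\<alpha>\<in>positive_roots n. \<alpha> m) = (\<Sum>\<alpha>\<in>?L. \<alpha> m) + (\<Sum>\<alpha>\<in>?D. \<alpha> m) + (\<Sum>\<alpha>\<in>?S. \<alpha> m)"
    unfolding roots using disj1 disj2 by (simp add: sum.union_disjoint)
  also have "\<dots> = (\<Sum>i\<in>{1..n}. 2 * eps i m) + (\<Sum>(j, i)\<in>?P. eps j m - eps i m) + (\<Sum>(j, i)\<in>?P. eps j m + eps i m)"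
    unfolding sum.reindex[OF injL] sum.reindex[OF injD] sum.reindex[OF injS]
    by (simp add: case_prod_unfold)
  \<comment> \<open>Between difference and sum the \<open>eps i\<close> parts cancel, leaving
    \<open>2 * eps j\<close> for each \<open>i < j\<close>, hence \<open>2 * (m - 1)\<close> at
    coordinate \<open>m\<close>; the long root adds \<open>2\<close>.\<close>
  also have "\<dots> = (\<Sum>i\<in>{1..n}. 2 * eps i m) + (\<Sum>(j, i)\<in>?P. 2 * eps j m)"
    by (simp add: sum.distrib[symmetric] case_prod_unfold add.assoc)
  also have "(\<Sum>(j, i)\<in>?P. 2 * eps j m) = (\<Sum>j\<in>{1..n}. \<Sum>i\<in>{1..<j}. 2 * eps j m)"
    by (rule sum.Sigma[symmetric]) auto
  also have "\<dots> = (\<Sum>j\<in>{1..n}. if j = m then 2 * real (m - 1) else 0)"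
    by (intro sum.cong) (auto simp: eps_def)
  also have "\<dots> = 2 * real (m - 1)" using m by simp
  also have "(\<Sum>i\<in>{1..n}. 2 * eps i m) = (\<Sum>i\<in>{1..n}. if i = m then 2 else 0)"
    by (intro sum.cong) (auto simp: eps_def)
  also have "\<dots> = 2" using m by simp
  finally show ?thesis using m by (simp add: of_nat_diff)
qed

lemma sum_eps: "i \<in> {1..n} \<Longrightarrow> (\<Sum>m=1..n. f m * eps i m) = f i"
  by (simp add: eps_def if_distrib[of "\<lambda>t. _ * t"] cong: if_cong)

text \<open>In coordinates \<open>2 * rho\<close> is \<open>2 * m\<close>. Its inner product with
  each simple root, \<open>4\<close> for the long one and \<open>2\<close> for the others, equals
  the squared length of that root.\<close>

lemma coroot_pairing_two_rho:
  assumes i: "i \<in> {1..n}"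
  shows "coroot_pairing n (\<lambda>m. 2 * rho n m) i = 2"
proof -
  have rho: "2 * rho n m = 2 * real m" if "m \<in> {1..n}" for m
    using sum_positive_roots[of m n] that by (simp add: rho_def)
  have x: "(\<Sum>m=1..n. (2 * rho n m) * simple_root i m) = (\<Sum>m=1..n. 2 * real m * simple_root i m)"
    by (intro sum.cong refl) (simp add: rho)
  show ?thesis
  proof (cases "i = 1")
    case True
    have "(\<Sum>m=1..n. 2 * real m * simple_root i m) = (\<Sum>m=1..n. (4 * real m) * eps 1 m)"
      using True by (intro sum.cong) (auto simp: simple_root_def)
    also have "\<dots> = 4" using True i by (subst sum_eps) auto
    finally have num: "(\<Sum>m=1..n. 2 * real m * simple_root i m) = 4" .
    have "(\<Sum>m=1..n. simple_root i m * simple_root i m) = (\<Sum>m=1..n. 4 * eps 1 m)"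
      using True by (intro sum.cong) (auto simp: simple_root_def eps_def)
    also have "\<dots> = 4" using True i by (subst sum_eps) auto
    finally show ?thesis unfolding coroot_pairing_def x num by simp
  next
    case False
    then have i': "i \<in> {1..n}" "i - 1 \<in> {1..n}" using i by auto
    have "(\<Sum>m=1..n. 2 * real m * simple_root i m) =
      (\<Sum>m=1..n. (2 * real m) * eps i m) - (\<Sum>m=1..n. (2 * real m) * eps (i - 1) m)"
      using False by (simp add: simple_root_def right_diff_distrib sum_subtractf)
    also have "\<dots> = 2"
      unfolding sum_eps[OF i'(1)] sum_eps[OF i'(2)] using i' by (simp add: of_nat_diff)
    finally have num: "(\<Sum>m=1..n. 2 * real m * simple_root i m) = 2" .
    have "(\<Sum>m=1..n. simple_root i m * simple_root i m) =
      (\<Sum>m=1..n. 1 * eps i m) + (\<Sum>m=1..n. 1 * eps (i - 1) m)"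
      unfolding sum.distrib[symmetric] using False i'
      by (intro sum.cong) (auto simp: simple_root_def eps_def)
    also have "\<dots> = 2"
      unfolding sum_eps[OF i'(1)] sum_eps[OF i'(2)] by simp
    finally show ?thesis unfolding coroot_pairing_def x num by simp
  qed
qed

text \<open>The partial sums are \<open>2 * k\<close>, and the shift by \<open>1\<close> at the
  nodes \<open>ANode\<close> splits each increase by \<open>2\<close> into two covers of difference
  \<open>1\<close>.\<close>

lemma center_two_rho:
  assumes "generating_rel n q p"
  shows "center n (\<lambda>m. 2 * rho n m) p - center n (\<lambda>m. 2 * rho n m) q = 1"
proof -
  have [simp]: "weight_partial_sum n (\<lambda>m. 2 * rho n m) k = 2 * real k" if "k \<le> n" for k
    unfolding weight_partial_sum_def using that by (simp add: coroot_pairing_two_rho)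
  show ?thesis using assms
    by (induction rule: generating_rel.induct) (auto simp: center_def of_nat_diff)
qed

theorem theorem3:
  "(\<forall>lam\<in>dominant_weights CARD('n).
      \<exists>s\<in>lattice_points. \<exists>t\<in>lattice_points.
        mutation_equiv_M ((+) s ` (GT lam :: (real ^ ('n::finite) coord) set))
                         ((+) t ` (FFLV lam :: (real ^ 'n coord) set)))
   \<and> mutation_equiv_N
       (dual (GT (\<lambda>m. 2 * rho CARD('n) m) :: (real ^ 'n coord) set))
       (dual (FFLV (\<lambda>m. 2 * rho CARD('n) m) :: (real ^ 'n coord) set))"
proof (intro conjI ballI)
  let ?n = "CARD('n)" and ?emb = "Rep_coord :: 'n coord \<Rightarrow> node"
  fix lam assume lam: "lam \<in> dominant_weights ?n"
  then have mp: "marked_poset (generating_rel ?n) ?emb (marked ?n) (center ?n lam) (node_rank ?n)"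
    by (intro type_C_marked_poset) (auto simp: dominant_weights_def)
  interpret marked_poset "generating_rel ?n" ?emb "marked ?n" "center ?n lam" "node_rank ?n"
    by (rule mp)
  note eqs = GT_eq_order_polytope[OF mp] FFLV_eq_chain_polytope[OF mp]
  have "mutation_equiv_M ((+) (- origin) ` (GT lam :: (real ^ 'n coord) set)) ((+) (- slack) ` FFLV lam)"
    using order_chain_mutation_equiv_M GT_nonempty[OF lam] unfolding eqs by blast
  moreover have "- origin \<in> lattice_points" "- slack \<in> lattice_points"
    using origin_lattice slack_lattice by (auto simp: lattice_points_def)
  ultimately show "\<exists>s\<in>lattice_points. \<exists>t\<in>lattice_points.
      mutation_equiv_M ((+) s ` (GT lam :: (real ^ 'n coord) set)) ((+) t ` FFLV lam)"
    by blast
next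
  let ?n = "CARD('n)" and ?emb = "Rep_coord :: 'n coord \<Rightarrow> node"
  let ?x = "\<lambda>m. 2 * rho ?n m"
  have mp: "marked_poset (generating_rel ?n) ?emb (marked ?n) (center ?n ?x) (node_rank ?n)"
    by (intro type_C_marked_poset) (simp add: coroot_pairing_two_rho)
  interpret marked_poset "generating_rel ?n" ?emb "marked ?n" "center ?n ?x" "node_rank ?n"
    by (rule mp)
  show "mutation_equiv_N (dual (GT ?x :: (real ^ 'n coord) set)) (dual (FFLV ?x))"
    unfolding GT_eq_order_polytope[OF mp] FFLV_eq_chain_polytope[OF mp]
    by (rule order_chain_mutation_equiv_N) (rule center_two_rho)
qed

end
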